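(* Let $\bar G=PSL_2(\mathbb{Q})$ and let $\bar G\curvearrowright Y$ be the action on the quotient $Y$ of $\widehat{\mathbb{Q}^2}$ by the relation identifying each $\phi\in\widehat{\mathbb{Q}^2}$ with $\phi'$, $\phi'(x,y):=\phi(-x,-y)$. Then $\bar{G}\curvearrowright Y$ is a free, weakly mixing and prime action.
   Context: Let $G=SL_2(\mathbb{Q})$, acting on the discrete group $\mathbb{Q}^2$ by matrix multiplication from the left. Let $G\curvearrowright \widehat{\mathbb{Q}^2}$ be the induced algebraic action on the Pontryagin dual (a compact metrizable abelian group with Haar probability measure), given by $(g\phi)(v)=\phi(g^{-1}v)$. $Y$ is the quotient of $\widehat{\mathbb{Q}^2}$ by the relation $\phi\sim\phi'$ where $\phi'(x,y):=\phi(-x,-y)$ for all $(x,y)\in\mathbb{Q}^2$, with the pushed-forward measure $\mu$ and the induced $G$-action. Since $-id$ acts trivially on $Y$, this descends to a probability-measure-preserving (p.m.p.) action $\bar G=PSL_2(\mathbb{Q})\curvearrowright (Y,\mu)$. Freeness is in the measure-theoretic (essential) sense. A p.m.p. action $\Gamma\curvearrowright(X,\mu)$ is weakly mixing if for every finite collection $\Omega$ of measurable subsets of $X$ and every $\epsilon>0$ there exists $s\in\Gamma$ with $|\mu(sA\cap B)-\mu(A)\mu(B)|<\epsilon$ for all $A,B\in\Omega$. A p.m.p. action is prime if it admits no non-trivial quotient (factor) actions, i.e. every measure-theoretic factor is either the one-point action or the action itself (up to isomorphism via the factor map). *)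

theory Defs
  imports "HOL-Probability.Probability" "HOL-Algebra.Algebra"
begin

section \<open>Probability-measure-preserving actions\<close>

text \<open>
  The underlying notion of action is that of HOL-Algebra: a homomorphism into the
  bijections of \<open>space M\<close>, extensional outside \<open>space M\<close>. The acting group is discrete.
\<close>

locale pmp_action = group_action \<Gamma> "space M" \<alpha> + prob_space M
  for \<Gamma> :: "('g, 'b) monoid_scheme" (structure)
    and M :: "'x measure"
    and \<alpha> :: "'g \<Rightarrow> 'x \<Rightarrow> 'x" +
  assumes action_measurable: "g \<in> carrier \<Gamma> \<Longrightarrow> \<alpha> g \<in> measurable M M"
    and action_preserving: "g \<in> carrier \<Gamma> \<Longrightarrow> distr M M (\<alpha> g) = M"

definition essentially_free ::
    "('g, 'b) monoid_scheme \<Rightarrow> 'x measure \<Rightarrow> ('g \<Rightarrow> 'x \<Rightarrow> 'x) \<Rightarrow> bool" where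
  "essentially_free \<Gamma> M \<alpha> \<longleftrightarrow> (AE x in M. stabilizer \<Gamma> \<alpha> x = {\<one>\<^bsub>\<Gamma>\<^esub>})"

definition weakly_mixing ::
    "('g, 'b) monoid_scheme \<Rightarrow> 'x measure \<Rightarrow> ('g \<Rightarrow> 'x \<Rightarrow> 'x) \<Rightarrow> bool" where
  "weakly_mixing \<Gamma> M \<alpha> \<longleftrightarrow>
    (\<forall>\<Omega> \<epsilon>. finite \<Omega> \<and> \<Omega> \<subseteq> sets M \<and> \<epsilon> > 0 \<longrightarrow>
      (\<exists>s \<in> carrier \<Gamma>. \<forall>A \<in> \<Omega>. \<forall>B \<in> \<Omega>.
        \<bar>measure M (\<alpha> s ` A \<inter> B) - measure M A * measure M B\<bar> < \<epsilon>))"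

definition standard_borel :: "'z measure \<Rightarrow> bool" where
  "standard_borel N \<longleftrightarrow>
    (\<exists>T. completely_metrizable_space T \<and> second_countable T \<and> topspace T = space N \<and>
      sets N = sigma_sets (topspace T) {U. openin T U})"

definition factor_map ::
    "('g, 'b) monoid_scheme \<Rightarrow> 'x measure \<Rightarrow> ('g \<Rightarrow> 'x \<Rightarrow> 'x) \<Rightarrow>
      'z measure \<Rightarrow> ('g \<Rightarrow> 'z \<Rightarrow> 'z) \<Rightarrow> ('x \<Rightarrow> 'z) \<Rightarrow> bool" where
  "factor_map \<Gamma> M \<alpha> N \<beta> \<pi> \<longleftrightarrow>
    \<pi> \<in> measurable M N \<and> distr M N \<pi> = N \<and>
    (\<forall>g \<in> carrier \<Gamma>. AE x in M. \<pi> (\<alpha> g x) = \<beta> g (\<pi> x))"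

definition one_point_mod_null :: "'z measure \<Rightarrow> bool" where
  "one_point_mod_null N \<longleftrightarrow> (\<exists>z \<in> space N. AE w in N. w = z)"

definition iso_mod_null :: "'x measure \<Rightarrow> 'z measure \<Rightarrow> ('x \<Rightarrow> 'z) \<Rightarrow> bool" where
  "iso_mod_null M N \<pi> \<longleftrightarrow>
    \<pi> \<in> measurable M N \<and> distr M N \<pi> = N \<and>
    (\<exists>\<psi> \<in> measurable N M. (AE x in M. \<psi> (\<pi> x) = x) \<and> (AE z in N. \<pi> (\<psi> z) = z))"

text \<open>
  Factors are p.m.p. actions on standard probability spaces. A definition cannot quantify over
  types, so the type carrying the factor spaces is an explicit argument; a theorem stated for a
  type variable \<open>'z\<close> covers factors on spaces of every type. (One type of cardinality at least
  the continuum already suffices, up to isomorphism.)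
\<close>

definition prime_action ::
    "'z itself \<Rightarrow> ('g, 'b) monoid_scheme \<Rightarrow> 'x measure \<Rightarrow> ('g \<Rightarrow> 'x \<Rightarrow> 'x) \<Rightarrow> bool" where
  "prime_action TYPE('z) \<Gamma> M \<alpha> \<longleftrightarrow>
    (\<forall>(N :: 'z measure) \<beta> \<pi>.
      standard_borel N \<and> pmp_action \<Gamma> N \<beta> \<and> factor_map \<Gamma> M \<alpha> N \<beta> \<pi> \<longrightarrow>
      one_point_mod_null N \<or> iso_mod_null M N \<pi>)"


section \<open>The groups\<close>

definition SL2Q :: "(rat^2^2) monoid" where
  "SL2Q = \<lparr>carrier = {A. det A = 1}, mult = (**), one = mat 1\<rparr>"

definition PSL2Q :: "(rat^2^2) set monoid" where
  "PSL2Q = SL2Q Mod {mat 1, - mat 1}"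


section \<open>The dual of the discrete group of rational vectors\<close>

definition dual :: "(rat^2 \<Rightarrow> complex) set" where
  "dual = {\<phi>. (\<forall>v. norm (\<phi> v) = 1) \<and> (\<forall>v w. \<phi> (v + w) = \<phi> v * \<phi> w)}"

text \<open>
  On \<open>rat^2 \<Rightarrow> complex\<close>, \<open>borel\<close> comes from the topology of pointwise convergence, which is the
  compact-open topology since \<open>rat^2\<close> is taken discrete. The dual is compact metrizable, so a
  translation-invariant Borel probability measure is automatically regular, and it is unique.
\<close>

definition haar_prob :: "(rat^2 \<Rightarrow> complex) measure \<Rightarrow> bool" where
  "haar_prob m \<longleftrightarrow>
    prob_space m \<and> sets m = sets (restrict_space borel dual) \<and>
    (\<forall>\<theta> \<in> dual. distr m m (\<lambda>\<phi> v. \<theta> v * \<phi> v) = m)"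

definition dual_act :: "rat^2^2 \<Rightarrow> (rat^2 \<Rightarrow> complex) \<Rightarrow> (rat^2 \<Rightarrow> complex)" where
  "dual_act g \<phi> = (\<lambda>v. \<phi> (matrix_inv g *v v))"


section \<open>The quotient space and the action on it\<close>

definition flip_rel :: "((rat^2 \<Rightarrow> complex) \<times> (rat^2 \<Rightarrow> complex)) set" where
  "flip_rel = {(\<phi>, \<phi>'). \<phi> \<in> dual \<and> \<phi>' \<in> dual \<and> (\<phi>' = \<phi> \<or> \<phi>' = (\<lambda>v. \<phi> (- v)))}"

definition Y :: "(rat^2 \<Rightarrow> complex) set set" where
  "Y = dual // flip_rel"

definition Y_proj :: "(rat^2 \<Rightarrow> complex) \<Rightarrow> (rat^2 \<Rightarrow> complex) set" where
  "Y_proj \<phi> = flip_rel `` {\<phi>}"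

text \<open>
  The quotient \<open>\<sigma>\<close>-algebra is the largest one making the projection measurable; as the classes are
  orbits of a finite group of homeomorphisms of a compact metrizable space, it is the Borel
  \<open>\<sigma>\<close>-algebra of the quotient topology.
\<close>

definition Y_measure :: "(rat^2 \<Rightarrow> complex) measure \<Rightarrow> (rat^2 \<Rightarrow> complex) set measure" where
  "Y_measure m =
    distr m (sigma Y {B. B \<subseteq> Y \<and> Y_proj -` B \<inter> dual \<in> sets m}) Y_proj"

text \<open>
  For a coset \<open>C = {g, - g}\<close> and a class \<open>y\<close> of \<open>\<phi>\<close>, the set below is the class of \<open>dual_act g \<phi>\<close>,
  so no representatives have to be chosen.
\<close>

definition Y_act :: "(rat^2^2) set \<Rightarrow> (rat^2 \<Rightarrow> complex) set \<Rightarrow> (rat^2 \<Rightarrow> complex) set" where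
  "Y_act C = (\<lambda>y \<in> Y. {dual_act g \<phi> | g \<phi>. g \<in> C \<and> \<phi> \<in> y})"

end

theory Submission
  imports Defs
begin

text \<open>
  All four properties are read off from the Fourier coefficients of even functions on the dual
  \<open>X\<close> of the rational plane. Functions on \<open>Y\<close> are the even functions on \<open>X\<close>, the real parts
  \<open>\<phi> \<mapsto> Re (\<phi> v)\<close> of the characters of \<open>X\<close> span them, and an element \<open>g\<close> of determinant one simply
  permutes the frequencies \<open>v\<close>. Two analytic facts carry the argument: Fourier coefficients along
  infinitely many different frequencies tend to zero (\<open>riemann_lebesgue\<close>), and the integral of a
  product is the sum of the products of the coefficients if one factor is even (\<open>parseval\<close>).

  The action preserves the measure because it is by group automorphisms of \<open>X\<close> and Haar measure
  is unique (\<open>haar_prob_unique\<close>). It is free because a point fixed by \<open>g \<noteq> \<plusminus> 1\<close> up to sign is a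
  character with value one at a certain nonzero vector, and such characters form a null set: the
  coefficients of its indicator function at all multiples of that vector are equal to its measure.
  It is weakly mixing because the diagonal matrices with entries \<open>2^n\<close> and \<open>2^-n\<close> move every nonzero
  frequency along an infinite orbit, so only the frequency zero contributes to the limit.

  For primeness, let \<open>P\<close> map \<open>X\<close> through \<open>Y\<close> onto a factor \<open>N\<close> and let \<open>D v\<close> be the conditional
  expectation of \<open>Re (\<phi> v)\<close> given \<open>P\<close>. By equivariance, the coefficient of \<open>D v\<close> at \<open>w\<close> is the
  same for all images of \<open>w\<close> under the stabiliser of \<open>v\<close>. Unless \<open>w\<close> is a multiple of \<open>v\<close>,
  there are infinitely many of them, and the coefficient vanishes. Because the group is transitive
  on nonzero vectors, the coefficient at \<open>s v\<close> is a number \<open>ratio s\<close> that does not depend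
  on \<open>v\<close>. The integral of \<open>D v * D w * D (s v + t w)\<close> for independent \<open>v\<close> and \<open>w\<close> equals
  \<open>ratio s * ratio t\<close>. Exchanging the roles of \<open>v\<close> and \<open>s v + t w\<close> gives
  \<open>ratio s * ratio t = ratio s * ratio (t / s)\<close>, so if \<open>ratio s \<noteq> 0\<close> then \<open>ratio\<close> is constant on
  the powers of \<open>s\<close>; square summability leaves only \<open>s = \<plusminus> 1\<close> (\<open>ratio_support\<close>). Finally
  \<open>ratio 1 = 2 * (ratio 1)\<^sup>2\<close>, so for all \<open>v \<noteq> 0\<close> either \<open>D v\<close> vanishes or \<open>D v\<close> is
  \<open>Re (\<phi> v)\<close> itself (\<open>conditional_expectation_dichotomy\<close>). In the first case every set of the factor
  has measure zero or one, and a standard Borel space with this property is one point up to null sets.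
  In the second case all \<open>Re (\<phi> v)\<close> are functions of \<open>P \<phi>\<close>, and they determine \<open>\<phi>\<close>
  up to sign by an explicit measurable formula (\<open>character_from_real_parts\<close>), which inverts the
  factor map.
\<close>

section \<open>Characters of the rational plane\<close>

lemma dual_norm: "\<phi> \<in> dual \<Longrightarrow> norm (\<phi> v) = 1"
  and dual_add: "\<phi> \<in> dual \<Longrightarrow> \<phi> (v + w) = \<phi> v * \<phi> w"
  by (auto simp: dual_def)

lemma dual_zero: assumes "\<phi> \<in> dual" shows "\<phi> 0 = 1"
proof -
  have "\<phi> 0 = \<phi> 0 * \<phi> 0" using dual_add[OF assms, of 0 0] by simp
  moreover have "\<phi> 0 \<noteq> 0" using dual_norm[OF assms, of 0] by auto
  ultimately show ?thesis by simp
qed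

lemma dual_uminus: assumes "\<phi> \<in> dual" shows "\<phi> (- v) = cnj (\<phi> v)"
proof -
  have "\<phi> v * \<phi> (- v) = 1" using dual_add[OF assms, of v "- v"] dual_zero[OF assms] by simp
  moreover have "\<phi> v * cnj (\<phi> v) = 1"
    using dual_norm[OF assms, of v] by (simp add: complex_norm_square[symmetric])
  moreover have "\<phi> v \<noteq> 0" using dual_norm[OF assms, of v] by auto
  ultimately show ?thesis by (metis mult_left_cancel)
qed

lemma dual_mult: "\<theta> \<in> dual \<Longrightarrow> \<phi> \<in> dual \<Longrightarrow> (\<lambda>v. \<theta> v * \<phi> v) \<in> dual"
  by (auto simp: dual_def norm_mult)

lemma one_in_dual: "(\<lambda>v. 1) \<in> dual"
  by (simp add: dual_def)

lemma dual_act_in_dual: "\<phi> \<in> dual \<Longrightarrow> dual_act g \<phi> \<in> dual"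
  by (auto simp: dual_def dual_act_def matrix_vector_right_distrib)

lemma flip_in_dual: "\<phi> \<in> dual \<Longrightarrow> (\<lambda>v. \<phi> (- v)) \<in> dual"
  by (auto simp: dual_uminus dual_def)

text \<open>The circle is divisible, and the explicit characters \<open>w \<mapsto> exp (i t w\<^sub>j)\<close> make this concrete.\<close>

lemma dual_value_exists:
  assumes "v \<noteq> 0"
  shows "\<exists>\<theta> \<in> dual. \<theta> v = cis t"
proof -
  obtain j where j: "v $ j \<noteq> 0" using assms by (auto simp: vec_eq_iff)
  let ?\<theta> = "\<lambda>w::rat^2. cis (t * real_of_rat (w $ j) / real_of_rat (v $ j))"
  have "?\<theta> \<in> dual"
    by (auto simp: dual_def cis_mult of_rat_add algebra_simps add_divide_distrib)
  moreover have "?\<theta> v = cis t" using j by simp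
  ultimately show ?thesis by (intro bexI[where x = "?\<theta>"])
qed

text \<open>Tychonoff: the dual is a closed subset of a product of circles.\<close>

lemma compact_dual: "compact dual"
proof -
  have eq: "dual = (PiE UNIV (\<lambda>v. sphere 0 1)) \<inter> (\<Inter>v. \<Inter>w. {\<phi>. \<phi> (v + w) = \<phi> v * \<phi> w})"
    by (auto simp: dual_def PiE_UNIV_domain)
  have "compactin (product_topology (\<lambda>i::rat^2. euclidean) UNIV)
      (PiE UNIV (\<lambda>v. sphere (0::complex) 1))"
    unfolding compactin_PiE by auto
  then have "compact (PiE UNIV (\<lambda>v::rat^2. sphere (0::complex) 1))"
    unfolding euclidean_product_topology by simp
  moreover have "closed (\<Inter>v::rat^2. \<Inter>w. {\<phi> :: rat^2 \<Rightarrow> complex. \<phi> (v + w) = \<phi> v * \<phi> w})"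
    by (intro closed_INT ballI closed_Collect_eq continuous_on_mult continuous_on_product_coordinates)
  ultimately show ?thesis unfolding eq by (rule compact_Int_closed)
qed

section \<open>Haar measure on the dual\<close>

locale haar_dual =
  fixes m :: "(rat^2 \<Rightarrow> complex) measure"
  assumes haar: "haar_prob m"
begin

sublocale prob_space m
  using haar by (simp add: haar_prob_def)

lemma sets_m: "sets m = sets (restrict_space borel dual)"
  using haar by (simp add: haar_prob_def)

lemma space_m: "space m = dual"
  using sets_eq_imp_space_eq[OF sets_m] by (simp add: space_restrict_space)

lemma measurable_coordinate [measurable]: "(\<lambda>\<phi>. \<phi> v) \<in> borel_measurable m"
proof -
  have "(\<lambda>\<phi>. \<phi> v) \<in> borel_measurable (restrict_space borel dual)"
    by (intro measurable_restrict_space1 borel_measurable_continuous_onI) simp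
  then show ?thesis by (simp cong: measurable_cong_sets add: sets_m)
qed

lemma measurable_into_dual:
  assumes "\<And>v. (\<lambda>x. f x v) \<in> borel_measurable M" "\<And>x. x \<in> space M \<Longrightarrow> f x \<in> dual"
  shows "f \<in> measurable M m"
proof -
  have "f \<in> measurable M borel"
    by (rule measurable_coordinatewise_then_product) (rule assms(1))
  then have "f \<in> measurable M (restrict_space borel dual)"
    by (rule measurable_restrict_space2[rotated]) (use assms(2) in auto)
  then show ?thesis by (simp cong: measurable_cong_sets add: sets_m)
qed

lemma dual_act_measurable [measurable]: "dual_act g \<in> measurable m m"
  by (rule measurable_into_dual) (auto simp: dual_act_def space_m dual_act_in_dual[unfolded dual_act_def])

lemma flip_measurable [measurable]: "(\<lambda>\<phi> v. \<phi> (- v)) \<in> measurable m m"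
  by (rule measurable_into_dual) (auto simp: space_m flip_in_dual)

lemma translate_measurable: "\<theta> \<in> dual \<Longrightarrow> (\<lambda>\<phi> v. \<theta> v * \<phi> v) \<in> measurable m m"
  by (rule measurable_into_dual) (auto simp: space_m dual_mult)

lemma distr_translate: "\<theta> \<in> dual \<Longrightarrow> distr m m (\<lambda>\<phi> v. \<theta> v * \<phi> v) = m"
  using haar by (simp add: haar_prob_def)

end

text \<open>For independent random characters with the two given laws, the product has either law, because each
law absorbs translations. Tonelli turns this into a proof.\<close>

lemma haar_prob_unique:
  assumes "haar_prob m" "haar_prob n"
  shows "m = n"
proof (rule measure_eqI)
  interpret M: haar_dual m using assms(1) by (simp add: haar_dual_def)
  interpret N: haar_dual n using assms(2) by (simp add: haar_dual_def)
  interpret pair_sigma_finite m n ..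
  show "sets m = sets n" by (simp add: M.sets_m N.sets_m)
  fix A assume A[measurable]: "A \<in> sets m"
  then have A'[measurable]: "A \<in> sets n" by (simp add: M.sets_m N.sets_m)
  have *: "(\<lambda>p v. fst p v * snd p v) \<in> measurable (m \<Otimes>\<^sub>M n) m"
  proof (rule M.measurable_into_dual)
    fix v :: "rat^2"
    have "(\<lambda>p. fst p v) \<in> borel_measurable (m \<Otimes>\<^sub>M n)"
      by (rule measurable_compose[OF measurable_fst M.measurable_coordinate])
    moreover have "(\<lambda>p. snd p v) \<in> borel_measurable (m \<Otimes>\<^sub>M n)"
      by (rule measurable_compose[OF measurable_snd N.measurable_coordinate])
    ultimately show "(\<lambda>p. fst p v * snd p v) \<in> borel_measurable (m \<Otimes>\<^sub>M n)"
      by (rule borel_measurable_times)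
  next
    fix p assume "p \<in> space (m \<Otimes>\<^sub>M n)"
    then show "(\<lambda>v. fst p v * snd p v) \<in> dual"
      by (cases p) (simp add: space_pair_measure M.space_m N.space_m dual_mult)
  qed
  have "(indicator A \<circ> (\<lambda>p v. fst p v * snd p v)) \<in> borel_measurable (m \<Otimes>\<^sub>M n)"
    by (rule measurable_comp[OF * borel_measurable_indicator[OF A]])
  then have meas: "(\<lambda>(\<phi>, \<psi>). indicator A (\<lambda>v. \<phi> v * \<psi> v) :: ennreal) \<in> borel_measurable (m \<Otimes>\<^sub>M n)"
    by (simp only: comp_def split_beta')
  have inner1: "(\<integral>\<^sup>+\<psi>. indicator A (\<lambda>v. \<phi> v * \<psi> v) \<partial>n) = emeasure n A" if "\<phi> \<in> space m" for \<phi>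
  proof -
    have "(\<integral>\<^sup>+\<psi>. indicator A (\<lambda>v. \<phi> v * \<psi> v) \<partial>n)
        = (\<integral>\<^sup>+\<psi>. indicator A \<psi> \<partial>distr n n (\<lambda>\<psi> v. \<phi> v * \<psi> v))"
      by (subst nn_integral_distr) (use that in \<open>auto simp: M.space_m N.translate_measurable\<close>)
    then show ?thesis using that by (simp add: N.distr_translate M.space_m)
  qed
  have inner2: "(\<integral>\<^sup>+\<phi>. indicator A (\<lambda>v. \<phi> v * \<psi> v) \<partial>m) = emeasure m A" if "\<psi> \<in> space n" for \<psi>
  proof -
    have "(\<integral>\<^sup>+\<phi>. indicator A (\<lambda>v. \<psi> v * \<phi> v) \<partial>m)
        = (\<integral>\<^sup>+\<phi>. indicator A \<phi> \<partial>distr m m (\<lambda>\<phi> v. \<psi> v * \<phi> v))"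
      by (subst nn_integral_distr) (use that in \<open>auto simp: N.space_m M.translate_measurable\<close>)
    then show ?thesis using that M.distr_translate[of \<psi>] by (simp only: N.space_m mult.commute) simp
  qed
  have "emeasure n A = (\<integral>\<^sup>+\<phi>. emeasure n A \<partial>m)" by (simp add: M.emeasure_space_1)
  also have "\<dots> = (\<integral>\<^sup>+\<phi>. \<integral>\<^sup>+\<psi>. indicator A (\<lambda>v. \<phi> v * \<psi> v) \<partial>n \<partial>m)"
    by (rule nn_integral_cong) (simp add: inner1)
  also have "\<dots> = (\<integral>\<^sup>+\<psi>. \<integral>\<^sup>+\<phi>. indicator A (\<lambda>v. \<phi> v * \<psi> v) \<partial>m \<partial>n)"
    by (rule Fubini'[symmetric]) (rule meas)
  also have "\<dots> = (\<integral>\<^sup>+\<psi>. emeasure m A \<partial>n)"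
    by (rule nn_integral_cong) (simp add: inner2)
  also have "\<dots> = emeasure m A" by (simp add: N.emeasure_space_1)
  finally show "emeasure m A = emeasure n A" by simp
qed

lemma matrix_inv_unique:
  fixes g h :: "rat^2^2"
  assumes "g ** h = mat 1"
  shows "matrix_inv g = h"
proof -
  have hg: "h ** g = mat 1" using assms by (simp add: matrix_left_right_inverse)
  have "g ** matrix_inv g = mat 1"
    unfolding matrix_inv_def by (rule someI2[where a = h]) (simp_all add: assms hg)
  then have "h ** (g ** matrix_inv g) = h" by simp
  then show ?thesis by (simp add: matrix_mul_assoc hg)
qed

lemma det_one_inverse:
  fixes g :: "rat^2^2"
  assumes "det g = 1"
  shows "matrix_inv g ** g = mat 1" "g ** matrix_inv g = mat 1"
proof -
  obtain h where "g ** h = mat 1" "h ** g = mat 1"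
    using assms invertible_det_nz[of g] by (auto simp: invertible_def)
  then show "matrix_inv g ** g = mat 1" "g ** matrix_inv g = mat 1"
    by (simp_all add: matrix_inv_unique)
qed

lemma det_one_inverse_vec:
  fixes g :: "rat^2^2"
  assumes "det g = 1"
  shows "matrix_inv g *v (g *v x) = x" "g *v (matrix_inv g *v x) = x"
  by (simp_all add: matrix_vector_mul_assoc det_one_inverse[OF assms])

context haar_dual
begin

text \<open>The image of Haar measure under an automorphism is again translation invariant: a translation by
\<open>\<theta>\<close> after \<open>g\<close> is a translation by \<open>\<theta> \<circ> g\<close> before it.\<close>

lemma distr_dual_act:
  assumes g: "det g = 1"
  shows "distr m m (dual_act g) = m"
proof (rule haar_prob_unique[OF _ haar])
  let ?n = "distr m m (dual_act g)"
  have "distr ?n ?n (\<lambda>\<phi> v. \<theta> v * \<phi> v) = ?n" if \<theta>: "\<theta> \<in> dual" for \<theta>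
  proof -
    define \<theta>' where "\<theta>' = (\<lambda>v. \<theta> (g *v v))"
    have \<theta>': "\<theta>' \<in> dual" using \<theta> by (auto simp: \<theta>'_def dual_def matrix_vector_right_distrib)
    have meas: "(\<lambda>\<phi> v. \<theta> v * \<phi> v) \<in> measurable m m" "(\<lambda>\<phi> v. \<theta>' v * \<phi> v) \<in> measurable m m"
      using translate_measurable \<theta> \<theta>' by auto
    have "distr ?n ?n (\<lambda>\<phi> v. \<theta> v * \<phi> v) = distr ?n m (\<lambda>\<phi> v. \<theta> v * \<phi> v)"
      by (rule distr_cong) auto
    also have "\<dots> = distr m m ((\<lambda>\<phi> v. \<theta> v * \<phi> v) \<circ> dual_act g)"
      by (rule distr_distr) (simp_all add: meas)
    also have "(\<lambda>\<phi> v. \<theta> v * \<phi> v) \<circ> dual_act g = dual_act g \<circ> (\<lambda>\<phi> v. \<theta>' v * \<phi> v)"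
      by (auto simp: fun_eq_iff dual_act_def \<theta>'_def det_one_inverse_vec[OF g])
    also have "distr m m (dual_act g \<circ> (\<lambda>\<phi> v. \<theta>' v * \<phi> v))
        = distr (distr m m (\<lambda>\<phi> v. \<theta>' v * \<phi> v)) m (dual_act g)"
      by (rule distr_distr[symmetric]) (simp_all add: meas)
    finally show ?thesis by (simp add: distr_translate[OF \<theta>'])
  qed
  then show "haar_prob ?n"
    by (auto simp: haar_prob_def prob_space_distr sets_m)
qed

lemma integral_dual_act:
  fixes f :: "_ \<Rightarrow> real"
  assumes "det g = 1" "f \<in> borel_measurable m"
  shows "(\<integral>\<phi>. f (dual_act g \<phi>) \<partial>m) = (\<integral>\<phi>. f \<phi> \<partial>m)"
proof -
  have "(\<integral>\<phi>. f \<phi> \<partial>m) = (\<integral>\<phi>. f \<phi> \<partial>distr m m (dual_act g))"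
    by (simp add: distr_dual_act assms)
  also have "\<dots> = (\<integral>\<phi>. f (dual_act g \<phi>) \<partial>m)"
    by (rule integral_distr) (use assms in auto)
  finally show ?thesis by simp
qed

end

section \<open>Density of trigonometric polynomials\<close>

lemma re_mult_re: "\<phi> \<in> dual \<Longrightarrow> Re (\<phi> v) * Re (\<phi> w) = (Re (\<phi> (v + w)) + Re (\<phi> (v - w))) / 2"
  and re_mult_im: "\<phi> \<in> dual \<Longrightarrow> Re (\<phi> v) * Im (\<phi> w) = (Im (\<phi> (v + w)) - Im (\<phi> (v - w))) / 2"
  and im_mult_im: "\<phi> \<in> dual \<Longrightarrow> Im (\<phi> v) * Im (\<phi> w) = (Re (\<phi> (v - w)) - Re (\<phi> (v + w))) / 2"
  using dual_add[of \<phi> v "- w"] by (simp_all add: dual_add dual_uminus)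

lemma abs_re_le_1: "\<phi> \<in> dual \<Longrightarrow> \<bar>Re (\<phi> v)\<bar> \<le> 1"
  using abs_Re_le_cmod[of "\<phi> v"] by (auto simp: dual_norm)

definition even_on_dual :: "((rat^2 \<Rightarrow> complex) \<Rightarrow> real) \<Rightarrow> bool" where
  "even_on_dual f \<longleftrightarrow> (\<forall>\<phi> \<in> dual. f (\<lambda>v. \<phi> (- v)) = f \<phi>)"

text \<open>Membership is closed under changes outside the dual. The product formulas for characters hold only
there, and without this freedom products of trigonometric polynomials would not be trigonometric
polynomials as functions on the whole type.\<close>

inductive trig_poly :: "((rat^2 \<Rightarrow> complex) \<Rightarrow> real) \<Rightarrow> bool" where
  re: "\<forall>\<phi> \<in> dual. p \<phi> = Re (\<phi> v) \<Longrightarrow> trig_poly p"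
| im: "\<forall>\<phi> \<in> dual. p \<phi> = Im (\<phi> v) \<Longrightarrow> trig_poly p"
| add: "trig_poly p \<Longrightarrow> trig_poly q \<Longrightarrow> \<forall>\<phi> \<in> dual. r \<phi> = p \<phi> + q \<phi> \<Longrightarrow> trig_poly r"
| scale: "trig_poly p \<Longrightarrow> \<forall>\<phi> \<in> dual. r \<phi> = c * p \<phi> \<Longrightarrow> trig_poly r"

lemma trig_poly_cong: "trig_poly p \<Longrightarrow> \<forall>\<phi> \<in> dual. q \<phi> = p \<phi> \<Longrightarrow> trig_poly q"
  by (rule trig_poly.scale[of p q 1]) auto

lemma trig_poly_Re: "trig_poly (\<lambda>\<phi>. Re (\<phi> v))"
  and trig_poly_Im: "trig_poly (\<lambda>\<phi>. Im (\<phi> v))"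
  by (auto intro: trig_poly.re[of _ v] trig_poly.im[of _ v])

lemma trig_poly_combination:
  assumes "trig_poly p" "trig_poly q"
  shows "trig_poly (\<lambda>\<phi>. a * p \<phi> + b * q \<phi>)"
proof (rule trig_poly.add)
  show "trig_poly (\<lambda>\<phi>. a * p \<phi>)" by (rule trig_poly.scale[OF assms(1)]) auto
  show "trig_poly (\<lambda>\<phi>. b * q \<phi>)" by (rule trig_poly.scale[OF assms(2)]) auto
qed simp

lemma trig_poly_continuous: "trig_poly p \<Longrightarrow> continuous_on dual p"
proof (induction rule: trig_poly.induct)
  case (re p v)
  have "continuous_on dual (\<lambda>\<phi>::rat^2 \<Rightarrow> complex. Re (\<phi> v))"
    by (intro continuous_on_Re continuous_on_subset[OF continuous_on_product_coordinates subset_UNIV])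
  then show ?case by (rule continuous_on_eq) (use re in simp)
next
  case (im p v)
  have "continuous_on dual (\<lambda>\<phi>::rat^2 \<Rightarrow> complex. Im (\<phi> v))"
    by (intro continuous_on_Im continuous_on_subset[OF continuous_on_product_coordinates subset_UNIV])
  then show ?case by (rule continuous_on_eq) (use im in simp)
next
  case (add p q r)
  have "continuous_on dual (\<lambda>\<phi>. p \<phi> + q \<phi>)" by (intro continuous_on_add add)
  then show ?case by (rule continuous_on_eq) (use add in simp)
next
  case (scale p r c)
  have "continuous_on dual (\<lambda>\<phi>. c * p \<phi>)" by (intro continuous_on_mult continuous_on_const scale)
  then show ?case by (rule continuous_on_eq) (use scale in simp)
qed

text \<open>The product formulas express a product of two characters by characters of sums and differences.\<close>

lemma trig_poly_mult_basic:
  assumes "trig_poly p"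
  shows "trig_poly (\<lambda>\<phi>. Re (\<phi> v) * p \<phi>) \<and> trig_poly (\<lambda>\<phi>. Im (\<phi> v) * p \<phi>)"
  using assms
proof (induction rule: trig_poly.induct)
  case (re p w)
  have t1: "trig_poly (\<lambda>\<phi>. 1/2 * Re (\<phi> (v + w)) + 1/2 * Re (\<phi> (v - w)))"
    by (rule trig_poly_combination[OF trig_poly_Re trig_poly_Re])
  have t2: "trig_poly (\<lambda>\<phi>. 1/2 * Im (\<phi> (w + v)) + (-1/2) * Im (\<phi> (w - v)))"
    by (rule trig_poly_combination[OF trig_poly_Im trig_poly_Im])
  show ?case
    by (intro conjI trig_poly_cong[OF t1] trig_poly_cong[OF t2]) (auto simp: re re_mult_re re_mult_im[of _ w v] mult.commute[of "Im _" "Re _"] add_divide_distrib diff_divide_distrib)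
next
  case (im p w)
  have t1: "trig_poly (\<lambda>\<phi>. 1/2 * Im (\<phi> (v + w)) + (-1/2) * Im (\<phi> (v - w)))"
    by (rule trig_poly_combination[OF trig_poly_Im trig_poly_Im])
  have t2: "trig_poly (\<lambda>\<phi>. 1/2 * Re (\<phi> (v - w)) + (-1/2) * Re (\<phi> (v + w)))"
    by (rule trig_poly_combination[OF trig_poly_Re trig_poly_Re])
  show ?case
    by (intro conjI trig_poly_cong[OF t1] trig_poly_cong[OF t2]) (auto simp: im re_mult_im im_mult_im add_divide_distrib diff_divide_distrib)
next
  case (add p q r)
  have t1: "trig_poly (\<lambda>\<phi>. 1 * (Re (\<phi> v) * p \<phi>) + 1 * (Re (\<phi> v) * q \<phi>))"
    by (rule trig_poly_combination) (use add.IH in auto)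
  have t2: "trig_poly (\<lambda>\<phi>. 1 * (Im (\<phi> v) * p \<phi>) + 1 * (Im (\<phi> v) * q \<phi>))"
    by (rule trig_poly_combination) (use add.IH in auto)
  show ?case
    by (intro conjI trig_poly_cong[OF t1] trig_poly_cong[OF t2]) (auto simp: add.hyps distrib_left)
next
  case (scale p r c)
  have t1: "trig_poly (\<lambda>\<phi>. c * (Re (\<phi> v) * p \<phi>) + 0 * (Re (\<phi> v) * p \<phi>))"
    by (rule trig_poly_combination) (use scale.IH in auto)
  have t2: "trig_poly (\<lambda>\<phi>. c * (Im (\<phi> v) * p \<phi>) + 0 * (Im (\<phi> v) * p \<phi>))"
    by (rule trig_poly_combination) (use scale.IH in auto)
  show ?case
    by (intro conjI trig_poly_cong[OF t1] trig_poly_cong[OF t2]) (auto simp: scale.hyps)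
qed

lemma trig_poly_mult:
  assumes "trig_poly p" "trig_poly q"
  shows "trig_poly (\<lambda>\<phi>. p \<phi> * q \<phi>)"
  using assms(1)
proof (induction rule: trig_poly.induct)
  case (re p v)
  then show ?case by (auto intro: trig_poly_cong[OF conjunct1[OF trig_poly_mult_basic[OF assms(2), of v]]])
next
  case (im p v)
  then show ?case by (auto intro: trig_poly_cong[OF conjunct2[OF trig_poly_mult_basic[OF assms(2), of v]]])
next
  case (add p' q' r)
  then show ?case
    by (auto intro!: trig_poly.add[of "\<lambda>\<phi>. p' \<phi> * q \<phi>" "\<lambda>\<phi>. q' \<phi> * q \<phi>"] simp: distrib_right)
next
  case (scale p' r c)
  then show ?case by (auto intro!: trig_poly.scale[of "\<lambda>\<phi>. p' \<phi> * q \<phi>" _ c])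
qed

lemma trig_poly_const: "trig_poly (\<lambda>\<phi>. c)"
  by (rule trig_poly.scale[OF trig_poly.re[of "\<lambda>_. 1" 0], of _ c]) (auto simp: dual_zero)

lemma trig_poly_dense:
  assumes "continuous_on dual g" "0 < e"
  shows "\<exists>p. trig_poly p \<and> (\<forall>\<phi> \<in> dual. \<bar>g \<phi> - p \<phi>\<bar> < e)"
proof (rule Stone_Weierstrass_HOL[OF compact_dual, where P = trig_poly])
  show "trig_poly (\<lambda>x. f x + g x)" if "trig_poly f \<and> trig_poly g" for f g
    using that by (auto intro: trig_poly.add)
  show "\<exists>f. trig_poly f \<and> f \<phi> \<noteq> f \<psi>" if \<phi>\<psi>: "\<phi> \<in> dual \<and> \<psi> \<in> dual \<and> \<phi> \<noteq> \<psi>" for \<phi> \<psi>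
  proof -
    obtain v where "\<phi> v \<noteq> \<psi> v" using \<phi>\<psi> by (auto simp: fun_eq_iff)
    then have "Re (\<phi> v) \<noteq> Re (\<psi> v) \<or> Im (\<phi> v) \<noteq> Im (\<psi> v)" by (simp add: complex_eq_iff)
    then show ?thesis
    proof
      assume "Re (\<phi> v) \<noteq> Re (\<psi> v)"
      moreover have "trig_poly (\<lambda>\<phi>. Re (\<phi> v))" by (rule trig_poly.re) auto
      ultimately show ?thesis by (intro exI[of _ "\<lambda>\<phi>. Re (\<phi> v)"] conjI)
    next
      assume "Im (\<phi> v) \<noteq> Im (\<psi> v)"
      moreover have "trig_poly (\<lambda>\<phi>. Im (\<phi> v))" by (rule trig_poly.im) auto
      ultimately show ?thesis by (intro exI[of _ "\<lambda>\<phi>. Im (\<phi> v)"] conjI)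
    qed
  qed
qed (use assms in \<open>auto intro: trig_poly_const trig_poly_continuous trig_poly_mult\<close>)

context haar_dual
begin

lemma integrable_bounded_on_dual:
  fixes f :: "(rat^2 \<Rightarrow> complex) \<Rightarrow> real"
  assumes "f \<in> borel_measurable m" "\<And>\<phi>. \<phi> \<in> dual \<Longrightarrow> \<bar>f \<phi>\<bar> \<le> B"
  shows "integrable m f"
  by (rule integrable_const_bound[of _ B]) (use assms in \<open>auto simp: space_m intro!: AE_I2\<close>)

lemma continuous_measurable:
  fixes f :: "(rat^2 \<Rightarrow> complex) \<Rightarrow> real"
  assumes "continuous_on dual f"
  shows "f \<in> borel_measurable m"
  using borel_measurable_continuous_on_restrict[OF assms]
  by (simp cong: measurable_cong_sets add: sets_m)

lemma continuous_bounded: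
  fixes f :: "(rat^2 \<Rightarrow> complex) \<Rightarrow> real"
  assumes "continuous_on dual f"
  obtains B where "\<And>\<phi>. \<phi> \<in> dual \<Longrightarrow> \<bar>f \<phi>\<bar> \<le> B"
  using compact_imp_bounded[OF compact_continuous_image[OF assms compact_dual]]
  by (auto simp: bounded_iff)

lemma continuous_integrable:
  fixes f :: "(rat^2 \<Rightarrow> complex) \<Rightarrow> real"
  assumes "continuous_on dual f"
  shows "integrable m f"
  using continuous_bounded[OF assms] integrable_bounded_on_dual continuous_measurable[OF assms]
  by metis

text \<open>Outer regularity replaces the set by an open one, and the distance to the complement gives
continuous functions increasing to the indicator of an open set.\<close>

lemma indicator_approx:
  fixes e :: real
  assumes A: "A \<in> sets m" and e: "0 < e"
  shows "\<exists>g. continuous_on dual g \<and> (\<integral>\<phi>. \<bar>indicator A \<phi> - g \<phi>\<bar> \<partial>m) < e"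
proof -
  have "closed dual" using compact_dual by (rule compact_imp_closed)
  then have db: "dual \<in> sets borel" by (rule borel_closed)
  have Ab: "A \<in> sets borel" "A \<subseteq> dual"
    using A db by (auto simp: sets_m sets_restrict_space_iff)
  have id: "(\<lambda>\<phi>. \<phi>) \<in> measurable m borel"
    by (simp cong: measurable_cong_sets add: sets_m measurable_restrict_space1)
  define m' where "m' = distr m borel (\<lambda>\<phi>. \<phi>)"
  have m': "sets m' = sets borel" by (simp add: m'_def)
  interpret m': prob_space m' unfolding m'_def by (rule prob_space_distr[OF id])
  have em: "emeasure m' U = emeasure m (U \<inter> dual)" if "U \<in> sets borel" for U
    unfolding m'_def using that by (subst emeasure_distr[OF id]) (auto simp: space_m)
  have fin: "emeasure m' (space m') \<noteq> \<infinity>" by simp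
  have "emeasure m' A < emeasure m' A + ennreal e"
    using e by (simp add: m'.emeasure_eq_measure ennreal_less_iff flip: ennreal_plus)
  then have "(INF U \<in> {U. A \<subseteq> U \<and> open U}. emeasure m' U) < emeasure m' A + ennreal e"
    by (simp add: outer_regular[OF m' fin Ab(1), symmetric])
  then obtain U where U: "A \<subseteq> U" "open U" "emeasure m' U < emeasure m' A + ennreal e"
    by (auto simp: INF_less_iff)
  have Um: "U \<inter> dual \<in> sets m"
    using U(2) db by (auto simp: sets_m sets_restrict_space_iff)
  have "emeasure m (U \<inter> dual) < emeasure m A + ennreal e"
    using U(3) Ab em[of U] em[of A] U(2) by (simp add: Int_absorb2)
  then have less: "measure m (U \<inter> dual) - measure m A < e"
    using e by (simp add: emeasure_eq_measure ennreal_less_iff flip: ennreal_plus)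
  \<comment> \<open>The case distinction is needed because \<open>infdist\<close> to the empty set is zero.\<close>
  define g where "g n \<phi> = (if U = UNIV then 1 else min 1 (real n * infdist \<phi> (- U)))" for n \<phi>
  have cont: "continuous_on dual (g n)" for n
    unfolding g_def by (cases "U = UNIV") (auto intro!: continuous_intros)
  have lim: "(\<lambda>n. g n \<phi>) \<longlonglongrightarrow> indicator U \<phi>" for \<phi>
  proof (cases "U = UNIV \<or> \<phi> \<notin> U")
    case True
    then show ?thesis by (cases "U = UNIV") (auto simp: g_def infdist_zero)
  next
    case False
    have "infdist \<phi> (- U) \<noteq> 0"
      using False U(2) in_closed_iff_infdist_zero[of "- U" \<phi>] by auto
    then have pos: "infdist \<phi> (- U) > 0" using infdist_nonneg[of \<phi> "- U"] by simp
    obtain N where N: "1 < real N * infdist \<phi> (- U)" using ex_less_of_nat_mult[OF pos] by blast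
    have "g n \<phi> = 1" if "N \<le> n" for n
    proof -
      have "real N * infdist \<phi> (- U) \<le> real n * infdist \<phi> (- U)"
        using that pos by (intro mult_right_mono) auto
      then show ?thesis using N False by (simp add: g_def)
    qed
    then have "eventually (\<lambda>n. g n \<phi> = 1) sequentially" by (auto simp: eventually_sequentially)
    then show ?thesis using False by (simp add: tendsto_eventually)
  qed
  have g01: "\<bar>g n \<phi>\<bar> \<le> 1" for n \<phi>
    by (auto simp: g_def abs_le_iff infdist_nonneg min_def)
  have [measurable]: "g n \<in> borel_measurable m" for n by (rule continuous_measurable[OF cont])
  note A[measurable] Um[measurable]
  have "(\<lambda>n. \<integral>\<phi>. \<bar>indicator A \<phi> - g n \<phi>\<bar> \<partial>m) \<longlonglongrightarrow> (\<integral>\<phi>. \<bar>indicator A \<phi> - indicator (U \<inter> dual) \<phi>\<bar> \<partial>m)"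
  proof (rule integral_dominated_convergence[where w = "\<lambda>_. 2"])
    show "AE \<phi> in m. (\<lambda>n. \<bar>indicator A \<phi> - g n \<phi>\<bar>) \<longlonglongrightarrow> \<bar>indicator A \<phi> - indicator (U \<inter> dual) \<phi>\<bar>"
    proof (rule AE_I2)
      fix \<phi> assume "\<phi> \<in> space m"
      then have "indicator (U \<inter> dual) \<phi> = (indicator U \<phi> :: real)" by (simp add: indicator_def space_m)
      then show "(\<lambda>n. \<bar>indicator A \<phi> - g n \<phi>\<bar>) \<longlonglongrightarrow> \<bar>indicator A \<phi> - indicator (U \<inter> dual) \<phi>\<bar>"
        by (auto intro!: tendsto_intros lim)
    qed
    show "AE \<phi> in m. norm \<bar>indicator A \<phi> - g n \<phi>\<bar> \<le> 2" for n
    proof (rule AE_I2)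
      fix \<phi>
      have "\<bar>indicator A \<phi> - g n \<phi>\<bar> \<le> \<bar>indicator A \<phi>\<bar> + \<bar>g n \<phi>\<bar>" by (rule abs_triangle_ineq4)
      also have "\<dots> \<le> 1 + 1" by (intro add_mono g01) (simp add: indicator_def)
      finally show "norm \<bar>indicator A \<phi> - g n \<phi>\<bar> \<le> 2" by simp
    qed
  qed auto
  moreover have "(\<integral>\<phi>. \<bar>indicator A \<phi> - indicator (U \<inter> dual) \<phi>\<bar> \<partial>m) < e"
  proof -
    have "(\<integral>\<phi>. \<bar>indicator A \<phi> - indicator (U \<inter> dual) \<phi>\<bar> \<partial>m :: real)
        = (\<integral>\<phi>. indicator (U \<inter> dual) \<phi> - indicator A \<phi> \<partial>m)"
      by (rule Bochner_Integration.integral_cong) (use U(1) Ab(2) in \<open>auto simp: indicator_def\<close>)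
    also have "\<dots> = measure m (U \<inter> dual) - measure m A"
      by (subst Bochner_Integration.integral_diff) (auto simp: emeasure_eq_measure)
    finally show ?thesis using less by simp
  qed
  ultimately have "eventually (\<lambda>n. (\<integral>\<phi>. \<bar>indicator A \<phi> - g n \<phi>\<bar> \<partial>m) < e) sequentially"
    by (rule order_tendstoD)
  then obtain n where "(\<integral>\<phi>. \<bar>indicator A \<phi> - g n \<phi>\<bar> \<partial>m) < e"
    by (auto simp: eventually_sequentially)
  then show ?thesis using cont[of n] by blast
qed

lemma integrable_approx:
  fixes f :: "(rat^2 \<Rightarrow> complex) \<Rightarrow> real"
  assumes "integrable m f" "0 < e"
  shows "\<exists>g. continuous_on dual g \<and> (\<integral>\<phi>. \<bar>f \<phi> - g \<phi>\<bar> \<partial>m) < e"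
  using assms
proof (induction arbitrary: e rule: integrable_induct)
  case (base A c)
  obtain g where g: "continuous_on dual g" "(\<integral>\<phi>. \<bar>indicator A \<phi> - g \<phi>\<bar> \<partial>m) < e / (\<bar>c\<bar> + 1)"
    using indicator_approx[OF base(1), of "e / (\<bar>c\<bar> + 1)"] base(3) by auto
  have "(\<integral>\<phi>. \<bar>indicator A \<phi> *\<^sub>R c - c * g \<phi>\<bar> \<partial>m) = (\<integral>\<phi>. \<bar>c\<bar> * \<bar>indicator A \<phi> - g \<phi>\<bar> \<partial>m)"
    by (rule Bochner_Integration.integral_cong) (simp_all add: abs_mult[symmetric] algebra_simps)
  also have "\<dots> = \<bar>c\<bar> * (\<integral>\<phi>. \<bar>indicator A \<phi> - g \<phi>\<bar> \<partial>m)" by simp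
  also have "\<dots> \<le> \<bar>c\<bar> * (e / (\<bar>c\<bar> + 1))" using g(2) by (intro mult_left_mono) auto
  also have "\<dots> < e" using base(3) by (simp add: field_simps)
  finally show ?case using g(1)
    by (intro exI[of _ "\<lambda>\<phi>. c * g \<phi>"] conjI continuous_on_mult continuous_on_const)
next
  case (add f h)
  obtain g1 where g1: "continuous_on dual g1" "(\<integral>\<phi>. \<bar>f \<phi> - g1 \<phi>\<bar> \<partial>m) < e / 2"
    using add.IH(1)[of "e / 2"] add.prems by auto
  obtain g2 where g2: "continuous_on dual g2" "(\<integral>\<phi>. \<bar>h \<phi> - g2 \<phi>\<bar> \<partial>m) < e / 2"
    using add.IH(2)[of "e / 2"] add.prems by auto
  note ints = add.hyps(1,2) continuous_integrable[OF g1(1)] continuous_integrable[OF g2(1)]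
  have "(\<integral>\<phi>. \<bar>f \<phi> + h \<phi> - (g1 \<phi> + g2 \<phi>)\<bar> \<partial>m) \<le> (\<integral>\<phi>. \<bar>f \<phi> - g1 \<phi>\<bar> + \<bar>h \<phi> - g2 \<phi>\<bar> \<partial>m)"
    by (rule integral_mono) (use ints in auto)
  also have "\<dots> = (\<integral>\<phi>. \<bar>f \<phi> - g1 \<phi>\<bar> \<partial>m) + (\<integral>\<phi>. \<bar>h \<phi> - g2 \<phi>\<bar> \<partial>m)"
    by (rule Bochner_Integration.integral_add) (use ints in auto)
  finally show ?case using g1 g2
    by (intro exI[of _ "\<lambda>\<phi>. g1 \<phi> + g2 \<phi>"] conjI continuous_on_add) auto
next
  case (lim f s)
  note [measurable] = borel_measurable_integrable[OF lim.hyps(1)] borel_measurable_integrable[OF lim.hyps(4)]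
  have "(\<lambda>i. \<integral>\<phi>. \<bar>f \<phi> - s i \<phi>\<bar> \<partial>m) \<longlonglongrightarrow> (\<integral>\<phi>. 0 \<partial>m)"
  proof (rule integral_dominated_convergence[where w = "\<lambda>\<phi>. 3 * \<bar>f \<phi>\<bar>"])
    show "AE \<phi> in m. (\<lambda>i. \<bar>f \<phi> - s i \<phi>\<bar>) \<longlonglongrightarrow> 0"
      using lim.hyps(2) by (intro AE_I2 tendsto_rabs_zero) (auto intro!: tendsto_eq_intros)
    show "AE \<phi> in m. norm \<bar>f \<phi> - s i \<phi>\<bar> \<le> 3 * \<bar>f \<phi>\<bar>" for i
      using lim.hyps(3)[of _ i] by (intro AE_I2) (smt (verit) real_norm_def)
  qed (use lim in auto)
  then have "eventually (\<lambda>i. (\<integral>\<phi>. \<bar>f \<phi> - s i \<phi>\<bar> \<partial>m) < e / 2) sequentially"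
    using lim.prems by (intro order_tendstoD(2)) auto
  then obtain i where i: "(\<integral>\<phi>. \<bar>f \<phi> - s i \<phi>\<bar> \<partial>m) < e / 2" by (auto simp: eventually_sequentially)
  obtain g where g: "continuous_on dual g" "(\<integral>\<phi>. \<bar>s i \<phi> - g \<phi>\<bar> \<partial>m) < e / 2"
    using lim.IH[of "e / 2" i] lim.prems by auto
  note ints = lim.hyps(1)[of i] lim.hyps(4) continuous_integrable[OF g(1)]
  have "(\<integral>\<phi>. \<bar>f \<phi> - g \<phi>\<bar> \<partial>m) \<le> (\<integral>\<phi>. \<bar>f \<phi> - s i \<phi>\<bar> + \<bar>s i \<phi> - g \<phi>\<bar> \<partial>m)"
    by (rule integral_mono) (use ints in auto)
  also have "\<dots> = (\<integral>\<phi>. \<bar>f \<phi> - s i \<phi>\<bar> \<partial>m) + (\<integral>\<phi>. \<bar>s i \<phi> - g \<phi>\<bar> \<partial>m)"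
    by (rule Bochner_Integration.integral_add) (use ints in auto)
  finally show ?case using g i by (intro exI[of _ g]) auto
qed

end

section \<open>Fourier coefficients of even functions\<close>

lemma minus_matrix_mult:
  fixes A B :: "rat^2^2"
  shows "(- A) ** B = - (A ** B)" "A ** (- B) = - (A ** B)" "(- A) *v x = - (A *v x)" "A *v (- x) = - (A *v x)"
  by (simp_all add: matrix_matrix_mult_def matrix_vector_mult_def vec_eq_iff sum_negf)

lemma dual_act_minus:
  "dual_act (- g) \<phi> v = \<phi> (- (matrix_inv g *v v))" if "det g = 1"
proof -
  have "matrix_inv (- g) = - matrix_inv g"
    by (rule matrix_inv_unique) (simp add: minus_matrix_mult det_one_inverse that)
  then show ?thesis by (simp add: dual_act_def minus_matrix_mult)
qed

lemma dual_act_minus_one: "dual_act (- mat 1) \<phi> = (\<lambda>v. \<phi> (- v))"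
  using matrix_inv_unique[of "mat 1" "mat 1"] by (simp add: fun_eq_iff dual_act_minus)

context haar_dual
begin

text \<open>Boundedness by a fixed constant at every point of the dual keeps all integrability side conditions
trivial; conditional expectations are truncated so that they satisfy it everywhere.\<close>

definition unit_bounded :: "((rat^2 \<Rightarrow> complex) \<Rightarrow> real) \<Rightarrow> bool" where
  "unit_bounded f \<longleftrightarrow> f \<in> borel_measurable m \<and> (\<forall>\<phi> \<in> dual. \<bar>f \<phi>\<bar> \<le> 1)"

lemma unit_boundedD:
  assumes "unit_bounded f"
  shows "f \<in> borel_measurable m" "\<phi> \<in> dual \<Longrightarrow> \<bar>f \<phi>\<bar> \<le> 1" "integrable m f"
proof -
  show f: "f \<in> borel_measurable m" and b: "\<phi> \<in> dual \<Longrightarrow> \<bar>f \<phi>\<bar> \<le> 1" for \<phi>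
    using assms by (auto simp: unit_bounded_def)
  show "integrable m f" by (rule integrable_bounded_on_dual[OF f b])
qed

lemma unit_bounded_Re: "unit_bounded (\<lambda>\<phi>. Re (\<phi> v))"
  by (auto simp: unit_bounded_def abs_re_le_1)

lemma unit_bounded_mult:
  "unit_bounded f \<Longrightarrow> unit_bounded g \<Longrightarrow> unit_bounded (\<lambda>\<phi>. f \<phi> * g \<phi>)"
  by (auto simp: unit_bounded_def abs_mult intro: mult_le_one)

lemma unit_bounded_indicator: "A \<in> sets m \<Longrightarrow> unit_bounded (indicator A)"
  by (auto simp: unit_bounded_def indicator_def)

lemma unit_bounded_dual_act:
  "unit_bounded f \<Longrightarrow> unit_bounded (\<lambda>\<phi>. f (dual_act g \<phi>))"
  by (auto simp: unit_bounded_def dual_act_in_dual intro: measurable_compose[OF dual_act_measurable])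

text \<open>Translation by a character with value \<open>- 1\<close> at \<open>v\<close> changes the sign of the integrand.\<close>

lemma integral_character:
  assumes "v \<noteq> 0"
  shows "(\<integral>\<phi>. Re (\<phi> v) \<partial>m) = 0"
proof -
  obtain \<theta> where \<theta>: "\<theta> \<in> dual" "\<theta> v = cis pi" using dual_value_exists[OF assms] by blast
  have "(\<integral>\<phi>. Re (\<phi> v) \<partial>m) = (\<integral>\<phi>. Re (\<phi> v) \<partial>distr m m (\<lambda>\<phi> v. \<theta> v * \<phi> v))"
    by (simp add: distr_translate \<theta>)
  also have "\<dots> = (\<integral>\<phi>. Re (\<theta> v * \<phi> v) \<partial>m)"
    by (rule integral_distr) (simp_all add: translate_measurable \<theta>)
  finally show ?thesis by (simp add: \<theta>(2))
qed

lemma integral_Re: "(\<integral>\<phi>. Re (\<phi> v) \<partial>m) = (if v = 0 then 1 else 0)"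
proof (cases "v = 0")
  case True
  have "(\<integral>\<phi>. Re (\<phi> 0) \<partial>m) = (\<integral>\<phi>. 1 \<partial>m)"
    by (rule Bochner_Integration.integral_cong) (auto simp: space_m dual_zero)
  then show ?thesis using True by (simp add: prob_space)
qed (simp add: integral_character)

definition fourier :: "((rat^2 \<Rightarrow> complex) \<Rightarrow> real) \<Rightarrow> rat^2 \<Rightarrow> real" where
  "fourier f x = (\<integral>\<phi>. f \<phi> * Re (\<phi> x) \<partial>m)"

lemma fourier_minus: "fourier f (- x) = fourier f x"
  unfolding fourier_def
  by (rule Bochner_Integration.integral_cong) (auto simp: space_m dual_uminus)

lemma fourier_zero: "fourier f 0 = (\<integral>\<phi>. f \<phi> \<partial>m)"
  unfolding fourier_def
  by (rule Bochner_Integration.integral_cong) (auto simp: space_m dual_zero)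

lemma fourier_mult_Re:
  assumes f: "unit_bounded f"
  shows "fourier (\<lambda>\<phi>. f \<phi> * Re (\<phi> v)) x = (fourier f (v + x) + fourier f (v - x)) / 2"
proof -
  have "fourier (\<lambda>\<phi>. f \<phi> * Re (\<phi> v)) x
      = (\<integral>\<phi>. (f \<phi> * Re (\<phi> (v + x)) + f \<phi> * Re (\<phi> (v - x))) / 2 \<partial>m)"
    unfolding fourier_def
  proof (rule Bochner_Integration.integral_cong)
    fix \<phi> assume "\<phi> \<in> space m"
    then have "f \<phi> * (Re (\<phi> v) * Re (\<phi> x)) = f \<phi> * ((Re (\<phi> (v + x)) + Re (\<phi> (v - x))) / 2)"
      by (simp only: space_m re_mult_re)
    then show "f \<phi> * Re (\<phi> v) * Re (\<phi> x) = (f \<phi> * Re (\<phi> (v + x)) + f \<phi> * Re (\<phi> (v - x))) / 2"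
      by (simp add: algebra_simps)
  qed simp
  also have "\<dots> = (fourier f (v + x) + fourier f (v - x)) / 2"
    unfolding fourier_def using unit_bounded_mult[OF f unit_bounded_Re, THEN unit_boundedD(3)] by simp
  finally show ?thesis .
qed

lemma fourier_Re: "fourier (\<lambda>\<phi>. Re (\<phi> v)) x = ((if v = - x then 1 else 0) + (if v = x then 1 else 0)) / 2"
proof -
  have "fourier (\<lambda>\<phi>. 1 * Re (\<phi> v)) x = (fourier (\<lambda>_. 1) (v + x) + fourier (\<lambda>_. 1) (v - x)) / 2"
    by (rule fourier_mult_Re) (simp add: unit_bounded_def)
  then show ?thesis by (simp add: fourier_def[of "\<lambda>_. 1"] integral_Re eq_neg_iff_add_eq_0)
qed

text \<open>For a set of frequencies closed under negation this is the orthogonal projection onto the span of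
their real parts: the frequencies \<open>x\<close> and \<open>- x\<close> give the same function, of squared norm one half,
and summing over both supplies the missing factor two. The frequency zero obeys the same formula, so
representatives modulo sign are never chosen.\<close>

definition partial_sum :: "((rat^2 \<Rightarrow> complex) \<Rightarrow> real) \<Rightarrow> (rat^2) set \<Rightarrow> (rat^2 \<Rightarrow> complex) \<Rightarrow> real" where
  "partial_sum f F \<phi> = (\<Sum>x\<in>F. fourier f x * Re (\<phi> x))"

definition symmetric_finite :: "(rat^2) set \<Rightarrow> bool" where
  "symmetric_finite F \<longleftrightarrow> finite F \<and> (\<forall>x \<in> F. - x \<in> F)"

lemma symmetric_finite_Un: "finite F \<Longrightarrow> symmetric_finite (F \<union> uminus ` F)"
  by (auto simp: symmetric_finite_def)

lemma partial_sum_measurable [measurable]: "partial_sum f F \<in> borel_measurable m"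
  unfolding partial_sum_def by measurable

lemma partial_sum_bounded: "\<phi> \<in> dual \<Longrightarrow> \<bar>partial_sum f F \<phi>\<bar> \<le> (\<Sum>x\<in>F. \<bar>fourier f x\<bar>)"
  unfolding partial_sum_def
  by (intro sum_abs[THEN order_trans] sum_mono) (auto simp: abs_mult abs_re_le_1 intro: mult_left_le)

lemma integrable_mult_partial_sum:
  assumes "unit_bounded g"
  shows "integrable m (\<lambda>\<phi>. g \<phi> * partial_sum f F \<phi>)"
proof (rule integrable_bounded_on_dual)
  show "(\<lambda>\<phi>. g \<phi> * partial_sum f F \<phi>) \<in> borel_measurable m"
    using unit_boundedD(1)[OF assms] by measurable
  show "\<bar>g \<phi> * partial_sum f F \<phi>\<bar> \<le> 1 * (\<Sum>x\<in>F. \<bar>fourier f x\<bar>)" if "\<phi> \<in> dual" for \<phi>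
    unfolding abs_mult
    by (intro mult_mono partial_sum_bounded that unit_boundedD(2)[OF assms]) auto
qed

lemma integral_mult_partial_sum:
  assumes g: "unit_bounded g"
  shows "(\<integral>\<phi>. g \<phi> * partial_sum f F \<phi> \<partial>m) = (\<Sum>x\<in>F. fourier f x * fourier g x)"
proof -
  have i: "integrable m (\<lambda>\<phi>. g \<phi> * Re (\<phi> x))" for x
    using unit_bounded_mult[OF g unit_bounded_Re] by (rule unit_boundedD(3))
  have "(\<integral>\<phi>. g \<phi> * partial_sum f F \<phi> \<partial>m) = (\<integral>\<phi>. (\<Sum>x\<in>F. fourier f x * (g \<phi> * Re (\<phi> x))) \<partial>m)"
    by (rule Bochner_Integration.integral_cong) (auto simp: partial_sum_def sum_distrib_left mult_ac)
  also have "\<dots> = (\<Sum>x\<in>F. fourier f x * fourier g x)"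
    unfolding fourier_def[of g] using i by (subst Bochner_Integration.integral_sum) auto
  finally show ?thesis .
qed

lemma fourier_partial_sum:
  assumes F: "symmetric_finite F" and x: "x \<in> F"
  shows "(\<integral>\<phi>. Re (\<phi> x) * partial_sum f F \<phi> \<partial>m) = fourier f x"
proof -
  have fin: "finite F" and neg: "- x \<in> F" using F x by (auto simp: symmetric_finite_def)
  have eq: "fourier (\<lambda>\<phi>. Re (\<phi> x)) y = (if y = - x then 1 / 2 else 0) + (if y = x then 1 / 2 else 0)" for y
    unfolding fourier_Re using minus_minus[of x] minus_minus[of y] by (auto simp del: minus_minus)
  have "(\<integral>\<phi>. Re (\<phi> x) * partial_sum f F \<phi> \<partial>m)
      = (\<Sum>y\<in>F. fourier f y * fourier (\<lambda>\<phi>. Re (\<phi> x)) y)"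
    by (rule integral_mult_partial_sum[OF unit_bounded_Re])
  also have "\<dots> = (\<Sum>y\<in>F. if y = - x then fourier f y * (1 / 2) else 0)
      + (\<Sum>y\<in>F. if y = x then fourier f y * (1 / 2) else 0)"
    unfolding sum.distrib[symmetric] eq by (rule sum.cong) (auto simp: distrib_left fourier_minus)
  also have "\<dots> = fourier f (- x) * (1 / 2) + fourier f x * (1 / 2)"
    by (simp only: sum.delta[OF fin] neg x if_True)
  finally show ?thesis by (simp only: fourier_minus)
qed

lemma integrable_partial_sum_square: "integrable m (\<lambda>\<phi>. partial_sum f F \<phi> * partial_sum f F \<phi>)"
proof (rule integrable_bounded_on_dual)
  show "\<bar>partial_sum f F \<phi> * partial_sum f F \<phi>\<bar> \<le> (\<Sum>x\<in>F. \<bar>fourier f x\<bar>) * (\<Sum>x\<in>F. \<bar>fourier f x\<bar>)"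
    if "\<phi> \<in> dual" for \<phi>
    unfolding abs_mult by (intro mult_mono partial_sum_bounded that sum_nonneg) auto
qed measurable

lemma integral_partial_sum_square:
  assumes "symmetric_finite F"
  shows "(\<integral>\<phi>. partial_sum f F \<phi> * partial_sum f F \<phi> \<partial>m) = (\<Sum>x\<in>F. (fourier f x)\<^sup>2)"
proof -
  have "(\<integral>\<phi>. partial_sum f F \<phi> * partial_sum f F \<phi> \<partial>m)
      = (\<integral>\<phi>. (\<Sum>x\<in>F. fourier f x * (Re (\<phi> x) * partial_sum f F \<phi>)) \<partial>m)"
    by (rule Bochner_Integration.integral_cong) (simp_all add: partial_sum_def[of f F] sum_distrib_right mult_ac)
  also have "\<dots> = (\<Sum>x\<in>F. fourier f x * fourier f x)"
    using integrable_mult_partial_sum[OF unit_bounded_Re]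
    by (subst Bochner_Integration.integral_sum) (auto simp: fourier_partial_sum[OF assms] intro!: sum.cong)
  finally show ?thesis by (simp add: power2_eq_square)
qed

text \<open>Pythagoras for the projection \<open>partial_sum\<close>.\<close>

lemma residual_square:
  assumes f: "unit_bounded f" and F: "symmetric_finite F"
  shows "integrable m (\<lambda>\<phi>. (f \<phi> - partial_sum f F \<phi>)\<^sup>2)"
    "(\<integral>\<phi>. (f \<phi> - partial_sum f F \<phi>)\<^sup>2 \<partial>m) = (\<integral>\<phi>. f \<phi> * f \<phi> \<partial>m) - (\<Sum>x\<in>F. (fourier f x)\<^sup>2)"
proof -
  have eq: "(f \<phi> - partial_sum f F \<phi>)\<^sup>2
      = f \<phi> * f \<phi> - 2 * (f \<phi> * partial_sum f F \<phi>) + partial_sum f F \<phi> * partial_sum f F \<phi>" for \<phi>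
    by (simp add: power2_eq_square algebra_simps)
  note ints = unit_bounded_mult[OF f f, THEN unit_boundedD(3)] integrable_mult_partial_sum[OF f, of f F]
    integrable_partial_sum_square[of f F]
  show "integrable m (\<lambda>\<phi>. (f \<phi> - partial_sum f F \<phi>)\<^sup>2)" unfolding eq using ints by auto
  show "(\<integral>\<phi>. (f \<phi> - partial_sum f F \<phi>)\<^sup>2 \<partial>m) = (\<integral>\<phi>. f \<phi> * f \<phi> \<partial>m) - (\<Sum>x\<in>F. (fourier f x)\<^sup>2)"
    unfolding eq using ints
    by (simp add: integral_mult_partial_sum[OF f] integral_partial_sum_square[OF F] power2_eq_square)
qed

lemma bessel:
  assumes f: "unit_bounded f" and F: "finite F"
  shows "(\<Sum>x\<in>F. (fourier f x)\<^sup>2) \<le> (\<integral>\<phi>. f \<phi> * f \<phi> \<partial>m)"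
proof -
  have "(\<Sum>x\<in>F. (fourier f x)\<^sup>2) \<le> (\<Sum>x\<in>F \<union> uminus ` F. (fourier f x)\<^sup>2)"
    by (rule sum_mono2) (use F in auto)
  also have "\<dots> \<le> (\<integral>\<phi>. f \<phi> * f \<phi> \<partial>m)"
    using residual_square(2)[OF f symmetric_finite_Un[OF F]]
      integral_nonneg_AE[where M = m and f = "\<lambda>\<phi>. (f \<phi> - partial_sum f (F \<union> uminus ` F) \<phi>)\<^sup>2"] by simp
  finally show ?thesis .
qed

text \<open>The squares of these coefficients are summable by Bessel's inequality.\<close>

lemma riemann_lebesgue:
  assumes f: "unit_bounded f" and x: "inj x"
  shows "(\<lambda>n::nat. fourier f (x n)) \<longlonglongrightarrow> 0"
proof -
  have "summable (\<lambda>n. (fourier f (x n))\<^sup>2)"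
  proof (rule bounded_imp_summable)
    fix n
    have "(\<Sum>k\<le>n. (fourier f (x k))\<^sup>2) = (\<Sum>y\<in>x ` {..n}. (fourier f y)\<^sup>2)"
      by (rule sum.reindex_cong[symmetric]) (use x in \<open>auto intro: inj_on_subset\<close>)
    then show "(\<Sum>k\<le>n. (fourier f (x k))\<^sup>2) \<le> (\<integral>\<phi>. f \<phi> * f \<phi> \<partial>m)"
      using bessel[OF f, of "x ` {..n}"] by simp
  qed simp
  then have "(\<lambda>n. (fourier f (x n))\<^sup>2) \<longlonglongrightarrow> 0" by (rule summable_LIMSEQ_zero)
  then have "(\<lambda>n. sqrt ((fourier f (x n))\<^sup>2)) \<longlonglongrightarrow> sqrt 0" by (rule tendsto_real_sqrt)
  then show ?thesis by (simp add: tendsto_rabs_zero_iff)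
qed

text \<open>This is the only form in which infinite orbits of frequencies enter the proofs of freeness and
primeness.\<close>

corollary fourier_constant_on_infinite:
  assumes "unit_bounded f" "inj (x :: nat \<Rightarrow> _)" "\<And>n. fourier f (x n) = c"
  shows "c = 0"
  using riemann_lebesgue[OF assms(1,2)] assms(3) by (simp add: LIMSEQ_const_iff)

text \<open>On the set \<open>E\<close> in question every character of a multiple of \<open>v\<close> equals one, so the indicator
function of \<open>E\<close> has the coefficient \<open>measure m E\<close> at infinitely many frequencies.\<close>

lemma AE_character_neq_one:
  assumes v: "v \<noteq> 0"
  shows "AE \<phi> in m. \<phi> v \<noteq> 1"
proof -
  define E where "E = {\<phi> \<in> space m. \<phi> v = 1}"
  have E[measurable]: "E \<in> sets m" unfolding E_def by measurable
  define x where "x n = (\<chi> i. of_nat n * v $ i)" for n :: nat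
  have x_Suc: "x (Suc n) = x n + v" for n by (simp add: x_def vec_eq_iff algebra_simps)
  have pow: "\<phi> (x n) = 1" if "\<phi> \<in> E" for \<phi> n
  proof (induction n)
    case 0
    have "x 0 = 0" by (simp add: x_def vec_eq_iff)
    then show ?case using that by (simp add: E_def space_m dual_zero)
  next
    case (Suc n)
    then show ?case using that by (simp add: x_Suc dual_add E_def space_m)
  qed
  have "inj x"
  proof (rule injI)
    fix k n assume "x k = x n"
    then have "of_nat k * v $ i = of_nat n * v $ i" for i unfolding x_def vec_eq_iff by (simp only: vec_lambda_beta)
    moreover obtain i where "v $ i \<noteq> 0" using v by (auto simp: vec_eq_iff)
    ultimately show "k = n" by (metis mult_right_cancel of_nat_eq_iff)
  qed
  moreover have "fourier (indicator E) (x n) = measure m E" for n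
  proof -
    have "fourier (indicator E) (x n) = (\<integral>\<phi>. indicator E \<phi> \<partial>m)"
      unfolding fourier_def
      by (rule Bochner_Integration.integral_cong) (auto simp: indicator_def pow)
    then show ?thesis by simp
  qed
  ultimately have "measure m E = 0"
    using fourier_constant_on_infinite[OF unit_bounded_indicator[OF E]] by blast
  then have "AE \<phi> in m. \<phi> \<notin> E" by (simp add: AE_iff_measurable[OF E] emeasure_eq_measure E_def)
  then show ?thesis by (auto simp: E_def)
qed

lemma partial_sum_even: "even_on_dual (partial_sum f F)"
  by (auto simp: even_on_dual_def partial_sum_def dual_uminus intro!: sum.cong)

text \<open>Imaginary parts of characters are odd.\<close>

lemma integral_even_mult_Im:
  assumes "even_on_dual r" "r \<in> borel_measurable m"
  shows "(\<integral>\<phi>. r \<phi> * Im (\<phi> x) \<partial>m) = 0"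
proof -
  have flip: "dual_act (- mat 1) \<phi> = (\<lambda>v. \<phi> (- v))" for \<phi>
    by (simp add: dual_act_minus_one)
  have "(\<integral>\<phi>. r \<phi> * Im (\<phi> x) \<partial>m) = (\<integral>\<phi>. r (dual_act (- mat 1) \<phi>) * Im (dual_act (- mat 1) \<phi> x) \<partial>m)"
    by (rule integral_dual_act[symmetric]) (use assms in \<open>auto simp: det_2 mat_def\<close>)
  also have "\<dots> = (\<integral>\<phi>. - (r \<phi> * Im (\<phi> x)) \<partial>m)"
    by (rule Bochner_Integration.integral_cong)
      (use assms(1) in \<open>auto simp: flip space_m even_on_dual_def dual_uminus\<close>)
  finally show ?thesis by simp
qed

text \<open>Being orthogonal to an unspecified finite set of frequencies is what survives of an explicit
expansion of a trigonometric polynomial. Only real parts need to be listed, because even functions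
are orthogonal to all imaginary parts.\<close>

definition spectrum_in :: "((rat^2 \<Rightarrow> complex) \<Rightarrow> real) \<Rightarrow> (rat^2) set \<Rightarrow> bool" where
  "spectrum_in p F \<longleftrightarrow> (\<forall>r B. even_on_dual r \<and> r \<in> borel_measurable m \<and> (\<forall>\<phi>\<in>dual. \<bar>r \<phi>\<bar> \<le> B) \<and>
    (\<forall>x \<in> F. (\<integral>\<phi>. r \<phi> * Re (\<phi> x) \<partial>m) = 0) \<longrightarrow> (\<integral>\<phi>. r \<phi> * p \<phi> \<partial>m) = 0)"

lemma spectrum_inD:
  "spectrum_in p F \<Longrightarrow> even_on_dual r \<Longrightarrow> r \<in> borel_measurable m \<Longrightarrow> \<forall>\<phi>\<in>dual. \<bar>r \<phi>\<bar> \<le> B \<Longrightarrow>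
    \<forall>x \<in> F. (\<integral>\<phi>. r \<phi> * Re (\<phi> x) \<partial>m) = 0 \<Longrightarrow> (\<integral>\<phi>. r \<phi> * p \<phi> \<partial>m) = 0"
  unfolding spectrum_in_def by blast

lemma trig_poly_spectrum:
  assumes "trig_poly p"
  shows "\<exists>F. finite F \<and> spectrum_in p F"
  using assms
proof (induction rule: trig_poly.induct)
  case (re p v)
  have "(\<integral>\<phi>. r \<phi> * p \<phi> \<partial>m) = (\<integral>\<phi>. r \<phi> * Re (\<phi> v) \<partial>m)" for r
    by (rule Bochner_Integration.integral_cong) (auto simp: space_m re)
  then show ?case by (intro exI[of _ "{v}"]) (simp add: spectrum_in_def)
next
  case (im p v)
  have "(\<integral>\<phi>. r \<phi> * p \<phi> \<partial>m) = (\<integral>\<phi>. r \<phi> * Im (\<phi> v) \<partial>m)" for r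
    by (rule Bochner_Integration.integral_cong) (auto simp: space_m im)
  then show ?case by (intro exI[of _ "{}"]) (simp add: spectrum_in_def integral_even_mult_Im)
next
  case (add p q s)
  obtain F1 where F1: "finite F1" "spectrum_in p F1" using add.IH(1) by blast
  obtain F2 where F2: "finite F2" "spectrum_in q F2" using add.IH(2) by blast
  have sum: "(\<integral>\<phi>. r \<phi> * s \<phi> \<partial>m) = (\<integral>\<phi>. r \<phi> * p \<phi> \<partial>m) + (\<integral>\<phi>. r \<phi> * q \<phi> \<partial>m)"
    if r: "r \<in> borel_measurable m" "\<forall>\<phi>\<in>dual. \<bar>r \<phi>\<bar> \<le> B" for r B
  proof -
    have i: "integrable m (\<lambda>\<phi>. r \<phi> * t \<phi>)" if t: "trig_poly t" for t
    proof -
      obtain C where C: "\<And>\<phi>. \<phi> \<in> dual \<Longrightarrow> \<bar>t \<phi>\<bar> \<le> C"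
        using continuous_bounded[OF trig_poly_continuous[OF t]] by blast
      show ?thesis
      proof (rule integrable_bounded_on_dual)
        show "(\<lambda>\<phi>. r \<phi> * t \<phi>) \<in> borel_measurable m"
          using r(1) continuous_measurable[OF trig_poly_continuous[OF t]] by measurable
        show "\<bar>r \<phi> * t \<phi>\<bar> \<le> B * C" if "\<phi> \<in> dual" for \<phi>
          unfolding abs_mult using r(2) C that by (intro mult_mono) (auto intro: order_trans[OF abs_ge_zero])
      qed
    qed
    have "(\<integral>\<phi>. r \<phi> * s \<phi> \<partial>m) = (\<integral>\<phi>. r \<phi> * p \<phi> + r \<phi> * q \<phi> \<partial>m)"
      by (rule Bochner_Integration.integral_cong) (auto simp: space_m add.hyps distrib_left)
    then show ?thesis using i[OF add.hyps(1)] i[OF add.hyps(2)] by simp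
  qed
  show ?case
  proof (intro exI[of _ "F1 \<union> F2"] conjI)
    show "spectrum_in s (F1 \<union> F2)"
      unfolding spectrum_in_def
    proof (intro allI impI; elim conjE)
      fix r B
      assume r: "even_on_dual r" "r \<in> borel_measurable m" "\<forall>\<phi>\<in>dual. \<bar>r \<phi>\<bar> \<le> B"
        "\<forall>x \<in> F1 \<union> F2. (\<integral>\<phi>. r \<phi> * Re (\<phi> x) \<partial>m) = 0"
      have "(\<integral>\<phi>. r \<phi> * p \<phi> \<partial>m) = 0" by (rule spectrum_inD[OF F1(2) r(1-3)]) (use r(4) in simp)
      moreover have "(\<integral>\<phi>. r \<phi> * q \<phi> \<partial>m) = 0" by (rule spectrum_inD[OF F2(2) r(1-3)]) (use r(4) in simp)
      ultimately show "(\<integral>\<phi>. r \<phi> * s \<phi> \<partial>m) = 0" by (simp only: sum[OF r(2,3)] add_0)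
    qed
  qed (use F1(1) F2(1) in simp)
next
  case (scale p s c)
  have "(\<integral>\<phi>. r \<phi> * s \<phi> \<partial>m) = c * (\<integral>\<phi>. r \<phi> * p \<phi> \<partial>m)" for r
  proof -
    have "(\<integral>\<phi>. r \<phi> * s \<phi> \<partial>m) = (\<integral>\<phi>. c * (r \<phi> * p \<phi>) \<partial>m)"
      by (rule Bochner_Integration.integral_cong) (auto simp: space_m scale.hyps)
    then show ?thesis by simp
  qed
  note eq = this
  obtain F where F: "finite F" "spectrum_in p F" using scale.IH by blast
  have "spectrum_in s F"
    unfolding spectrum_in_def
  proof (intro allI impI; elim conjE)
    fix r B
    assume r: "even_on_dual r" "r \<in> borel_measurable m" "\<forall>\<phi>\<in>dual. \<bar>r \<phi>\<bar> \<le> B"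
      "\<forall>x \<in> F. (\<integral>\<phi>. r \<phi> * Re (\<phi> x) \<partial>m) = 0"
    show "(\<integral>\<phi>. r \<phi> * s \<phi> \<partial>m) = 0" by (simp add: eq spectrum_inD[OF F(2) r])
  qed
  then show ?case using F(1) by blast
qed

text \<open>A continuous approximation in mean is first truncated to \<open>[-1, 1]\<close>, which moves it closer to \<open>f\<close>;
for functions bounded in this way, closeness in mean implies closeness in mean square.\<close>

lemma square_approx:
  assumes f: "unit_bounded f" and e: "0 < e"
  shows "\<exists>p. trig_poly p \<and> (\<integral>\<phi>. (f \<phi> - p \<phi>)\<^sup>2 \<partial>m) < e"
proof -
  define d where "d = min 1 (e / 9)"
  have d: "0 < d" "d \<le> 1" "9 * d \<le> e" using e by (auto simp: d_def)
  obtain g where g: "continuous_on dual g" "(\<integral>\<phi>. \<bar>f \<phi> - g \<phi>\<bar> \<partial>m) < d"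
    using integrable_approx[OF unit_boundedD(3)[OF f] d(1)] by blast
  define h where "h \<phi> = max (- 1) (min 1 (g \<phi>))" for \<phi>
  have h: "continuous_on dual h" unfolding h_def by (intro continuous_intros g)
  obtain p where p: "trig_poly p" "\<And>\<phi>. \<phi> \<in> dual \<Longrightarrow> \<bar>h \<phi> - p \<phi>\<bar> < d"
    using trig_poly_dense[OF h d(1)] by blast
  have bound: "(f \<phi> - p \<phi>)\<^sup>2 \<le> 3 * \<bar>f \<phi> - g \<phi>\<bar> + 3 * d" if \<phi>: "\<phi> \<in> dual" for \<phi>
  proof -
    have f1: "\<bar>f \<phi>\<bar> \<le> 1" by (rule unit_boundedD(2)[OF f \<phi>])
    have "\<bar>f \<phi> - h \<phi>\<bar> \<le> \<bar>f \<phi> - g \<phi>\<bar>" using f1 by (auto simp: h_def)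
    then have 1: "\<bar>f \<phi> - p \<phi>\<bar> \<le> \<bar>f \<phi> - g \<phi>\<bar> + d" using p(2)[OF \<phi>] by linarith
    have "\<bar>h \<phi>\<bar> \<le> 1" by (auto simp: h_def)
    then have 2: "\<bar>f \<phi> - p \<phi>\<bar> \<le> 3" using f1 p(2)[OF \<phi>] d(2) by linarith
    have "(f \<phi> - p \<phi>)\<^sup>2 = \<bar>f \<phi> - p \<phi>\<bar> * \<bar>f \<phi> - p \<phi>\<bar>" by (simp add: power2_eq_square)
    also have "\<dots> \<le> 3 * (\<bar>f \<phi> - g \<phi>\<bar> + d)" by (rule mult_mono[OF 2 1]) auto
    finally show ?thesis by simp
  qed
  have ig: "integrable m (\<lambda>\<phi>. \<bar>f \<phi> - g \<phi>\<bar>)"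
    using unit_boundedD(3)[OF f] continuous_integrable[OF g(1)] by auto
  have "(\<integral>\<phi>. (f \<phi> - p \<phi>)\<^sup>2 \<partial>m) \<le> (\<integral>\<phi>. 3 * \<bar>f \<phi> - g \<phi>\<bar> + 3 * d \<partial>m)"
    by (rule integral_mono') (use ig bound in \<open>auto simp: space_m d(1) less_imp_le\<close>)
  also have "\<dots> = 3 * (\<integral>\<phi>. \<bar>f \<phi> - g \<phi>\<bar> \<partial>m) + 3 * d"
    using ig by (simp add: prob_space)
  also have "\<dots> < e" using g(2) d by linarith
  finally show ?thesis using p(1) by blast
qed

text \<open>The projection is at least as close to \<open>f\<close> as any trigonometric polynomial with frequencies in \<open>F\<close>.\<close>

lemma residual_small:
  assumes f: "unit_bounded f" and ev: "even_on_dual f" and G: "finite G" and e: "0 < e"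
  shows "\<exists>F. symmetric_finite F \<and> G \<subseteq> F \<and> (\<integral>\<phi>. (f \<phi> - partial_sum f F \<phi>)\<^sup>2 \<partial>m) < e"
proof -
  obtain p where p: "trig_poly p" "(\<integral>\<phi>. (f \<phi> - p \<phi>)\<^sup>2 \<partial>m) < e"
    using square_approx[OF f e] by blast
  obtain F0 where F0: "finite F0" "spectrum_in p F0"
    using trig_poly_spectrum[OF p(1)] by blast
  define F where "F = (F0 \<union> G) \<union> uminus ` (F0 \<union> G)"
  have F: "symmetric_finite F" "F0 \<subseteq> F" "G \<subseteq> F"
    unfolding F_def using symmetric_finite_Un[of "F0 \<union> G"] F0(1) G by auto
  define r where "r \<phi> = f \<phi> - partial_sum f F \<phi>" for \<phi>
  define B where "B = 1 + (\<Sum>x\<in>F. \<bar>fourier f x\<bar>)"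
  have rm[measurable]: "r \<in> borel_measurable m"
    using unit_boundedD(1)[OF f] unfolding r_def by measurable
  have rB: "\<bar>r \<phi>\<bar> \<le> B" if "\<phi> \<in> dual" for \<phi>
    using unit_boundedD(2)[OF f that] partial_sum_bounded[OF that, of f F] by (auto simp: r_def B_def)
  have rev: "even_on_dual r"
    using ev partial_sum_even[of f F] by (auto simp: even_on_dual_def r_def)
  have orth: "(\<integral>\<phi>. r \<phi> * Re (\<phi> x) \<partial>m) = 0" if "x \<in> F" for x
  proof -
    have "(\<integral>\<phi>. r \<phi> * Re (\<phi> x) \<partial>m) = (\<integral>\<phi>. f \<phi> * Re (\<phi> x) - Re (\<phi> x) * partial_sum f F \<phi> \<partial>m)"
      by (simp add: r_def algebra_simps)
    also have "\<dots> = fourier f x - (\<integral>\<phi>. Re (\<phi> x) * partial_sum f F \<phi> \<partial>m)"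
      unfolding fourier_def[of f x]
      by (rule Bochner_Integration.integral_diff)
        (auto intro: unit_boundedD(3)[OF unit_bounded_mult[OF f unit_bounded_Re]]
          integrable_mult_partial_sum[OF unit_bounded_Re])
    finally show ?thesis by (simp add: fourier_partial_sum[OF F(1) that])
  qed
  have rp: "(\<integral>\<phi>. r \<phi> * p \<phi> \<partial>m) = 0" using spectrum_inD[OF F0(2) rev rm, of B] rB orth F(2) by auto
  have ir: "integrable m (\<lambda>\<phi>. r \<phi> * Re (\<phi> x))" for x
  proof (rule integrable_bounded_on_dual)
    show "\<bar>r \<phi> * Re (\<phi> x)\<bar> \<le> B * 1" if "\<phi> \<in> dual" for \<phi>
      unfolding abs_mult using rB[OF that] abs_re_le_1[OF that] by (intro mult_mono) auto
  qed measurable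
  have rS: "(\<integral>\<phi>. r \<phi> * partial_sum f F \<phi> \<partial>m) = 0"
  proof -
    have "(\<integral>\<phi>. r \<phi> * partial_sum f F \<phi> \<partial>m) = (\<integral>\<phi>. (\<Sum>x\<in>F. fourier f x * (r \<phi> * Re (\<phi> x))) \<partial>m)"
      by (simp add: partial_sum_def sum_distrib_left mult_ac)
    also have "\<dots> = (\<Sum>x\<in>F. fourier f x * (\<integral>\<phi>. r \<phi> * Re (\<phi> x) \<partial>m))"
      by (subst Bochner_Integration.integral_sum) (auto simp: ir)
    also have "\<dots> = 0" by (simp add: orth)
    finally show ?thesis .
  qed
  have pm[measurable]: "p \<in> borel_measurable m"
    by (rule continuous_measurable[OF trig_poly_continuous[OF p(1)]])
  obtain C where C: "\<And>\<phi>. \<phi> \<in> dual \<Longrightarrow> \<bar>p \<phi>\<bar> \<le> C"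
    using continuous_bounded[OF trig_poly_continuous[OF p(1)]] by blast
  have fm[measurable]: "f \<in> borel_measurable m" by (rule unit_boundedD(1)[OF f])
  have i1: "integrable m (\<lambda>\<phi>. r \<phi> * (f \<phi> - p \<phi>))"
  proof (rule integrable_bounded_on_dual)
    show "\<bar>r \<phi> * (f \<phi> - p \<phi>)\<bar> \<le> B * (1 + C)" if "\<phi> \<in> dual" for \<phi>
      unfolding abs_mult using rB[OF that] C[OF that] unit_boundedD(2)[OF f that] by (intro mult_mono) auto
  qed measurable
  have i2: "integrable m (\<lambda>\<phi>. r \<phi> * p \<phi>)"
  proof (rule integrable_bounded_on_dual)
    show "\<bar>r \<phi> * p \<phi>\<bar> \<le> B * C" if "\<phi> \<in> dual" for \<phi>
      unfolding abs_mult using rB[OF that] C[OF that] by (intro mult_mono) auto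
  qed measurable
  have i3: "integrable m (\<lambda>\<phi>. r \<phi> * partial_sum f F \<phi>)"
    unfolding partial_sum_def sum_distrib_left
    using ir by (intro Bochner_Integration.integrable_sum) (subst mult.left_commute, simp)
  have i4: "integrable m (\<lambda>\<phi>. (f \<phi> - p \<phi>)\<^sup>2)"
  proof (rule integrable_bounded_on_dual)
    show "\<bar>(f \<phi> - p \<phi>)\<^sup>2\<bar> \<le> (1 + C)\<^sup>2" if "\<phi> \<in> dual" for \<phi>
      using C[OF that] unit_boundedD(2)[OF f that] by (simp add: abs_le_square_iff[symmetric])
  qed measurable
  have i5: "integrable m (\<lambda>\<phi>. (r \<phi>)\<^sup>2)" unfolding r_def by (rule residual_square(1)[OF f F(1)])
  \<comment> \<open>The residual is orthogonal to \<open>p\<close> and to the partial sum, so \<open>r\<^sup>2\<close> and \<open>r * (f - p)\<close> have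
    the same integral.\<close>
  have "(\<integral>\<phi>. (r \<phi>)\<^sup>2 \<partial>m) = (\<integral>\<phi>. r \<phi> * (f \<phi> - p \<phi>) + r \<phi> * p \<phi> - r \<phi> * partial_sum f F \<phi> \<partial>m)"
    by (rule Bochner_Integration.integral_cong) (simp_all add: r_def power2_eq_square algebra_simps)
  also have "\<dots> = (\<integral>\<phi>. r \<phi> * (f \<phi> - p \<phi>) \<partial>m)"
    using i1 i2 i3 by (simp add: rp rS)
  also have "\<dots> \<le> (\<integral>\<phi>. ((r \<phi>)\<^sup>2 + (f \<phi> - p \<phi>)\<^sup>2) / 2 \<partial>m)"
  proof (rule integral_mono)
    show "r \<phi> * (f \<phi> - p \<phi>) \<le> ((r \<phi>)\<^sup>2 + (f \<phi> - p \<phi>)\<^sup>2) / 2" for \<phi>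
      using sum_squares_bound[of "r \<phi>" "f \<phi> - p \<phi>"] by simp
  qed (use i1 i4 i5 in auto)
  also have "\<dots> = ((\<integral>\<phi>. (r \<phi>)\<^sup>2 \<partial>m) + (\<integral>\<phi>. (f \<phi> - p \<phi>)\<^sup>2 \<partial>m)) / 2"
    using i4 i5 by simp
  finally have "(\<integral>\<phi>. (r \<phi>)\<^sup>2 \<partial>m) \<le> (\<integral>\<phi>. (f \<phi> - p \<phi>)\<^sup>2 \<partial>m)" by (simp add: field_simps)
  then have "(\<integral>\<phi>. (r \<phi>)\<^sup>2 \<partial>m) < e" using p(2) by (rule order.strict_trans1)
  then show ?thesis using F unfolding r_def by blast
qed

text \<open>The set \<open>F\<close> depends on \<open>f\<close> alone. In the proof of mixing, \<open>g\<close> runs through a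
sequence of translates while \<open>F\<close> stays fixed.\<close>

theorem parseval:
  assumes f: "unit_bounded f" and ev: "even_on_dual f"
    and G: "finite G" and d: "0 < d"
  shows "\<exists>F. finite F \<and> G \<subseteq> F \<and> (\<forall>g. unit_bounded g \<longrightarrow> \<bar>(\<integral>\<phi>. f \<phi> * g \<phi> \<partial>m) - (\<Sum>x\<in>F. fourier f x * fourier g x)\<bar> \<le> d)"
proof -
  obtain F where F: "symmetric_finite F" "G \<subseteq> F"
    and less: "(\<integral>\<phi>. (f \<phi> - partial_sum f F \<phi>)\<^sup>2 \<partial>m) < d\<^sup>2"
    using residual_small[OF f ev G, of "d\<^sup>2"] d by auto
  define r where "r \<phi> = f \<phi> - partial_sum f F \<phi>" for \<phi>
  have ir: "integrable m (\<lambda>\<phi>. (r \<phi>)\<^sup>2)" unfolding r_def by (rule residual_square(1)[OF f F(1)])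
  have "\<bar>(\<integral>\<phi>. f \<phi> * g \<phi> \<partial>m) - (\<Sum>x\<in>F. fourier f x * fourier g x)\<bar> \<le> d" if g: "unit_bounded g" for g
  proof -
    have ifg: "integrable m (\<lambda>\<phi>. f \<phi> * g \<phi>)"
      by (rule unit_boundedD(3)[OF unit_bounded_mult[OF f g]])
    have "(\<integral>\<phi>. f \<phi> * g \<phi> \<partial>m) - (\<Sum>x\<in>F. fourier f x * fourier g x)
        = (\<integral>\<phi>. f \<phi> * g \<phi> - g \<phi> * partial_sum f F \<phi> \<partial>m)"
      using ifg integrable_mult_partial_sum[OF g] by (simp add: integral_mult_partial_sum[OF g])
    also have "\<dots> = (\<integral>\<phi>. r \<phi> * g \<phi> \<partial>m)" by (simp add: r_def algebra_simps)
    also have "\<bar>\<dots>\<bar> \<le> (\<integral>\<phi>. \<bar>r \<phi> * g \<phi>\<bar> \<partial>m)" by (rule integral_abs_bound)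
    also have "\<dots> \<le> (\<integral>\<phi>. ((r \<phi>)\<^sup>2 / d + d) / 2 \<partial>m)"
    proof (rule integral_mono')
      fix \<phi> assume "\<phi> \<in> space m"
      then have "\<bar>r \<phi> * g \<phi>\<bar> \<le> \<bar>r \<phi>\<bar>"
        using unit_boundedD(2)[OF g] by (auto simp: abs_mult space_m intro: mult_left_le)
      also have "\<bar>r \<phi>\<bar> \<le> ((r \<phi>)\<^sup>2 / d + d) / 2"
        using sum_squares_bound[of "\<bar>r \<phi>\<bar>" d] d by (simp add: field_simps power2_eq_square)
      finally show "\<bar>r \<phi> * g \<phi>\<bar> \<le> ((r \<phi>)\<^sup>2 / d + d) / 2" .
    qed (use ir d in auto)
    also have "\<dots> = ((\<integral>\<phi>. (r \<phi>)\<^sup>2 \<partial>m) / d + d) / 2" using ir by (simp add: prob_space)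
    also have "\<dots> \<le> d" using less d by (simp add: r_def field_simps power2_eq_square)
    finally show ?thesis .
  qed
  then show ?thesis using F by (auto simp: symmetric_finite_def)
qed

corollary parseval_finite:
  assumes f: "unit_bounded f" and ev: "even_on_dual f" and g: "unit_bounded g"
    and G: "finite G" "\<And>x. x \<notin> G \<Longrightarrow> fourier f x * fourier g x = 0"
  shows "(\<integral>\<phi>. f \<phi> * g \<phi> \<partial>m) = (\<Sum>x\<in>G. fourier f x * fourier g x)"
proof -
  have "\<bar>(\<integral>\<phi>. f \<phi> * g \<phi> \<partial>m) - (\<Sum>x\<in>G. fourier f x * fourier g x)\<bar> \<le> d" if d: "0 < d" for d
  proof -
    obtain F where F: "finite F" "G \<subseteq> F"
      "\<bar>(\<integral>\<phi>. f \<phi> * g \<phi> \<partial>m) - (\<Sum>x\<in>F. fourier f x * fourier g x)\<bar> \<le> d"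
      using parseval[OF f ev G(1) d] g by blast
    have "(\<Sum>x\<in>G. fourier f x * fourier g x) = (\<Sum>x\<in>F. fourier f x * fourier g x)"
      by (rule sum.mono_neutral_left) (use F G(2) in auto)
    then show ?thesis using F(3) by simp
  qed
  then have "\<bar>(\<integral>\<phi>. f \<phi> * g \<phi> \<partial>m) - (\<Sum>x\<in>G. fourier f x * fourier g x)\<bar> \<le> 0"
    by (rule field_le_epsilon) simp
  then show ?thesis by simp
qed

end

section \<open>The quotient by negation\<close>

abbreviation flip :: "(rat^2 \<Rightarrow> complex) \<Rightarrow> rat^2 \<Rightarrow> complex" where
  "flip \<phi> \<equiv> \<lambda>v. \<phi> (- v)"

lemma Y_proj_eq: "\<phi> \<in> dual \<Longrightarrow> Y_proj \<phi> = {\<phi>, flip \<phi>}"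
  by (auto simp: Y_proj_def flip_rel_def flip_in_dual)

lemma Y_eq: "Y = Y_proj ` dual"
  by (auto simp: Y_def Y_proj_def quotient_def)

lemma Y_proj_flip: "\<phi> \<in> dual \<Longrightarrow> Y_proj (flip \<phi>) = Y_proj \<phi>"
  by (auto simp: Y_proj_eq flip_in_dual)

lemma Y_proj_eq_iff: "\<phi> \<in> dual \<Longrightarrow> \<psi> \<in> dual \<Longrightarrow> Y_proj \<phi> = Y_proj \<psi> \<longleftrightarrow> \<phi> = \<psi> \<or> \<phi> = flip \<psi>"
  by (auto simp: Y_proj_eq doubleton_eq_iff)

context haar_dual
begin

lemma sets_Y_measure: "sets (Y_measure m) = {B. B \<subseteq> Y \<and> Y_proj -` B \<inter> dual \<in> sets m}" (is "_ = ?C")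
proof -
  have "sigma_algebra Y ?C"
    unfolding sigma_algebra_iff2
  proof (intro conjI ballI allI impI)
    show "{} \<in> ?C" by simp
    fix s assume "s \<in> ?C"
    then have "Y_proj -` (Y - s) \<inter> dual = space m - (Y_proj -` s \<inter> dual)" "Y_proj -` s \<inter> dual \<in> sets m"
      by (auto simp: Y_eq space_m)
    then show "Y - s \<in> ?C" by auto
  next
    fix A :: "nat \<Rightarrow> _" assume A: "range A \<subseteq> ?C"
    have "Y_proj -` (\<Union>i. A i) \<inter> dual = (\<Union>i. Y_proj -` A i \<inter> dual)" by auto
    also have "\<dots> \<in> sets m" using A by (intro sets.countable_UN) auto
    finally show "(\<Union>i. A i) \<in> ?C" using A by auto
  qed auto
  moreover have "sets (sigma Y ?C) = sigma_sets Y ?C" by (rule sets_measure_of) auto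
  ultimately show ?thesis
    unfolding Y_measure_def by (simp only: sets_distr sigma_algebra.sigma_sets_eq)
qed

lemma space_Y_measure: "space (Y_measure m) = Y"
  unfolding Y_measure_def by (simp add: space_measure_of_conv)

lemma Y_proj_measurable: "Y_proj \<in> measurable m (Y_measure m)"
  by (rule measurableI) (auto simp: sets_Y_measure space_Y_measure Y_eq space_m)

lemma Y_measure_distr: "distr m (Y_measure m) Y_proj = Y_measure m"
proof -
  have "distr m (Y_measure m) Y_proj = distr m (sigma Y {B. B \<subseteq> Y \<and> Y_proj -` B \<inter> dual \<in> sets m}) Y_proj"
    by (rule distr_cong) (simp_all add: Y_measure_def)
  then show ?thesis by (simp add: Y_measure_def)
qed

lemma emeasure_Y_measure:
  "B \<in> sets (Y_measure m) \<Longrightarrow> emeasure (Y_measure m) B = emeasure m (Y_proj -` B \<inter> dual)"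
  using emeasure_distr[OF Y_proj_measurable, of B] by (simp add: Y_measure_distr space_m)

lemma measure_Y_measure:
  "B \<in> sets (Y_measure m) \<Longrightarrow> measure (Y_measure m) B = measure m (Y_proj -` B \<inter> dual)"
  by (simp add: measure_def emeasure_Y_measure)

lemma prob_space_Y: "prob_space (Y_measure m)"
  using prob_space_distr[OF Y_proj_measurable] by (simp add: Y_measure_distr)

lemma measurable_from_Y:
  assumes "(\<lambda>\<phi>. f (Y_proj \<phi>)) \<in> measurable m N"
  shows "f \<in> measurable (Y_measure m) N"
proof (rule measurableI)
  show "f y \<in> space N" if "y \<in> space (Y_measure m)" for y
    using that measurable_space[OF assms] by (auto simp: space_Y_measure Y_eq space_m)
  fix B assume "B \<in> sets N"
  then have "(\<lambda>\<phi>. f (Y_proj \<phi>)) -` B \<inter> space m \<in> sets m" using assms by (rule measurable_sets[rotated])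
  moreover have "(\<lambda>\<phi>. f (Y_proj \<phi>)) -` B \<inter> space m = Y_proj -` (f -` B \<inter> Y) \<inter> dual"
    by (auto simp: Y_eq space_m)
  ultimately show "f -` B \<inter> space (Y_measure m) \<in> sets (Y_measure m)"
    by (simp add: sets_Y_measure space_Y_measure)
qed

text \<open>The set where \<open>P\<close> fails may not be measurable, so a measurable null set covering its preimage is
pushed down instead. This works after intersecting that null set with its flip, which makes it
saturated.\<close>

lemma AE_Y_measure:
  assumes "AE \<phi> in m. P (Y_proj \<phi>)"
  shows "AE y in Y_measure m. P y"
proof -
  obtain N where N: "{\<phi> \<in> space m. \<not> P (Y_proj \<phi>)} \<subseteq> N" "emeasure m N = 0" "N \<in> sets m"
    using assms by (rule AE_E)
  define N' where "N' = N \<inter> {\<phi> \<in> space m. flip \<phi> \<in> N}"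
  have N'm: "N' \<in> sets m"
    using measurable_sets[OF flip_measurable N(3)] N(3) by (auto simp: N'_def vimage_def Int_def conj_commute)
  have sub: "N' \<subseteq> dual" using sets.sets_into_space[OF N'm] by (simp add: space_m)
  have flip: "\<phi> \<in> N' \<Longrightarrow> flip \<phi> \<in> N'" for \<phi>
    using sets.sets_into_space[OF N(3)] by (auto simp: N'_def space_m flip_in_dual)
  have pre: "Y_proj -` (Y_proj ` N') \<inter> dual = N'"
  proof (intro equalityI subsetI)
    fix \<phi> assume "\<phi> \<in> Y_proj -` (Y_proj ` N') \<inter> dual"
    then obtain \<psi> where "\<psi> \<in> N'" "Y_proj \<phi> = Y_proj \<psi>" "\<phi> \<in> dual" by auto
    then show "\<phi> \<in> N'" using Y_proj_eq_iff[of \<phi> \<psi>] flip[of \<psi>] sub by auto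
  qed (use sub in auto)
  have B: "Y_proj ` N' \<in> sets (Y_measure m)"
    using N'm sub by (auto simp: sets_Y_measure pre Y_eq)
  have "emeasure m N' = 0"
    using emeasure_mono[of N' N m] N(2,3) by (auto simp: N'_def)
  then have "Y_proj ` N' \<in> null_sets (Y_measure m)"
    using B by (simp add: null_sets_def emeasure_Y_measure pre)
  moreover have "{y \<in> space (Y_measure m). \<not> P y} \<subseteq> Y_proj ` N'"
  proof
    fix y assume "y \<in> {y \<in> space (Y_measure m). \<not> P y}"
    then obtain \<phi> where \<phi>: "\<phi> \<in> dual" "y = Y_proj \<phi>" "\<not> P (Y_proj \<phi>)" by (auto simp: space_Y_measure Y_eq)
    then have "\<phi> \<in> N'" using N(1) by (auto simp: N'_def space_m flip_in_dual Y_proj_flip)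
    then show "y \<in> Y_proj ` N'" using \<phi>(2) by blast
  qed
  ultimately show ?thesis by (rule AE_I')
qed

lemma AE_from_Y_measure:
  assumes "AE y in Y_measure m. P y"
  shows "AE \<phi> in m. P (Y_proj \<phi>)"
  using AE_distrD[OF Y_proj_measurable, of P] assms by (simp only: Y_measure_distr)

end

section \<open>The action of the projective group\<close>

lemma det_minus: "det (- g) = det (g :: rat^2^2)"
  by (simp add: det_2)

lemma dual_act_one: "dual_act (mat 1) \<phi> = \<phi>"
  using matrix_inv_unique[of "mat 1" "mat 1"] by (simp add: dual_act_def)

lemma dual_act_mult:
  assumes "det g = 1" "det h = 1"
  shows "dual_act (g ** h) \<phi> = dual_act g (dual_act h \<phi>)"
proof -
  have "(g ** h) ** (matrix_inv h ** matrix_inv g) = g ** (h ** matrix_inv h) ** matrix_inv g"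
    by (simp add: matrix_mul_assoc)
  also have "\<dots> = mat 1" by (simp add: det_one_inverse assms)
  finally have "matrix_inv (g ** h) = matrix_inv h ** matrix_inv g" by (rule matrix_inv_unique)
  then show ?thesis by (simp add: dual_act_def matrix_vector_mul_assoc)
qed

lemma det_matrix_inv: 
  fixes g :: "rat^2^2"
  assumes "det g = 1" shows "det (matrix_inv g) = 1"
  using det_mul[of g "matrix_inv g"] by (simp add: det_one_inverse assms)

lemma dual_act_inverse:
  assumes "det g = 1"
  shows "dual_act g (dual_act (matrix_inv g) \<phi>) = \<phi>" "dual_act (matrix_inv g) (dual_act g \<phi>) = \<phi>"
  by (simp_all add: dual_act_mult[symmetric] assms det_matrix_inv det_one_inverse dual_act_one)

lemma dual_act_neg: "det g = 1 \<Longrightarrow> dual_act (- g) \<phi> = flip (dual_act g \<phi>)"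
  by (simp add: fun_eq_iff dual_act_minus) (simp add: dual_act_def minus_matrix_mult)

lemma dual_act_flip: "dual_act g (flip \<phi>) = flip (dual_act g \<phi>)"
  by (simp add: fun_eq_iff dual_act_def minus_matrix_mult)

lemma SL2Q_simps: "carrier SL2Q = {g. det g = 1}" "x \<otimes>\<^bsub>SL2Q\<^esub> y = x ** y" "\<one>\<^bsub>SL2Q\<^esub> = mat 1"
  by (simp_all add: SL2Q_def)

lemma group_SL2Q: "group SL2Q"
proof (rule groupI)
  show "\<exists>h\<in>carrier SL2Q. h \<otimes>\<^bsub>SL2Q\<^esub> g = \<one>\<^bsub>SL2Q\<^esub>" if "g \<in> carrier SL2Q" for g
    using that by (intro bexI[of _ "matrix_inv g"]) (auto simp: SL2Q_simps det_one_inverse det_matrix_inv)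
qed (auto simp: SL2Q_simps det_mul matrix_mul_assoc)

lemma coset_eq: "{mat 1, - mat 1} #>\<^bsub>SL2Q\<^esub> g = {g, - g}"
  by (auto simp: r_coset_def SL2Q_simps minus_matrix_mult)

lemma normal_center: "{mat 1, - mat 1} \<lhd> SL2Q"
proof -
  interpret group SL2Q by (rule group_SL2Q)
  have "subgroup {mat 1, - mat 1} SL2Q"
  proof (rule subgroupI)
    show "inv\<^bsub>SL2Q\<^esub> a \<in> {mat 1, - mat 1}" if "a \<in> {mat 1, - mat 1}" for a
    proof -
      have "a \<otimes>\<^bsub>SL2Q\<^esub> a = \<one>\<^bsub>SL2Q\<^esub>" using that by (auto simp: SL2Q_simps minus_matrix_mult)
      moreover have "a \<in> carrier SL2Q" using that by (auto simp: SL2Q_simps det_minus)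
      ultimately have "inv\<^bsub>SL2Q\<^esub> a = a" by (simp add: inv_equality)
      then show ?thesis using that by simp
    qed
  qed (auto simp: SL2Q_simps det_minus minus_matrix_mult)
  then show ?thesis
    by (rule normalI) (auto simp: r_coset_def l_coset_def SL2Q_simps minus_matrix_mult)
qed

lemma group_PSL2Q: "group PSL2Q"
  unfolding PSL2Q_def by (rule normal.factorgroup_is_group[OF normal_center])

lemma carrier_PSL2Q: "carrier PSL2Q = {{g, - g} | g. det g = 1}"
  by (auto simp: PSL2Q_def carrier_FactGroup coset_eq SL2Q_simps)

lemma one_PSL2Q: "\<one>\<^bsub>PSL2Q\<^esub> = {mat 1, - mat 1}"
  by (simp add: PSL2Q_def)

lemma mult_PSL2Q: "{g, - g} \<otimes>\<^bsub>PSL2Q\<^esub> {h, - h} = {g ** h, - (g ** h)}"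
  by (auto simp: PSL2Q_def set_mult_def SL2Q_simps minus_matrix_mult)

lemma Y_act_proj:
  assumes g: "det g = 1" and \<phi>: "\<phi> \<in> dual"
  shows "Y_act {g, - g} (Y_proj \<phi>) = Y_proj (dual_act g \<phi>)"
proof -
  have "Y_act {g, - g} (Y_proj \<phi>) = {dual_act k \<psi> | k \<psi>. k \<in> {g, - g} \<and> \<psi> \<in> {\<phi>, flip \<phi>}}"
    unfolding Y_act_def using \<phi> by (simp add: Y_eq Y_proj_eq)
  also have "\<dots> = {dual_act g \<phi>, flip (dual_act g \<phi>)}"
  proof -
    have "{dual_act k \<psi> | k \<psi>. k \<in> {g, - g} \<and> \<psi> \<in> {\<phi>, flip \<phi>}}
        = (\<lambda>(k, \<psi>). dual_act k \<psi>) ` ({g, - g} \<times> {\<phi>, flip \<phi>})" by auto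
    then show ?thesis by (auto simp: dual_act_neg[OF g] dual_act_flip)
  qed
  finally show ?thesis using \<phi> by (simp add: Y_proj_eq dual_act_in_dual)
qed

lemma Y_act_mult:
  assumes "det g = 1" "det h = 1" "y \<in> Y"
  shows "Y_act {g, - g} (Y_act {h, - h} y) = Y_act {g ** h, - (g ** h)} y"
  using assms by (auto simp: Y_eq Y_act_proj dual_act_in_dual dual_act_mult det_mul)

lemma Y_act_in_Y: "det g = 1 \<Longrightarrow> y \<in> Y \<Longrightarrow> Y_act {g, - g} y \<in> Y"
  by (auto simp: Y_eq Y_act_proj dual_act_in_dual)

lemma Y_act_one: "y \<in> Y \<Longrightarrow> Y_act {mat 1, - mat 1} y = y"
  by (auto simp: Y_eq Y_act_proj dual_act_one)

lemma Y_act_Bij: assumes g: "det g = 1" shows "Y_act {g, - g} \<in> Bij Y"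
proof -
  have "bij_betw (Y_act {g, - g}) Y Y"
    by (rule bij_betw_byWitness[where f' = "Y_act {matrix_inv g, - matrix_inv g}"])
      (auto simp: Y_act_mult Y_act_one Y_act_in_Y g det_matrix_inv det_one_inverse)
  then show ?thesis by (auto simp: Bij_def Y_act_def)
qed

lemma group_action_Y: "group_action PSL2Q Y Y_act"
proof -
  have "Y_act \<in> hom PSL2Q (BijGroup Y)"
  proof (rule homI)
    show "Y_act C \<in> carrier (BijGroup Y)" if "C \<in> carrier PSL2Q" for C
      using that by (auto simp: carrier_PSL2Q BijGroup_def Y_act_Bij)
    fix C D assume "C \<in> carrier PSL2Q" "D \<in> carrier PSL2Q"
    then obtain g h where gh: "det g = 1" "C = {g, - g}" "det h = 1" "D = {h, - h}"
      by (auto simp: carrier_PSL2Q)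
    have "Y_act {g ** h, - (g ** h)} = compose Y (Y_act {g, - g}) (Y_act {h, - h})"
    proof
      fix y
      show "Y_act {g ** h, - (g ** h)} y = compose Y (Y_act {g, - g}) (Y_act {h, - h}) y"
        by (cases "y \<in> Y") (simp_all add: compose_def Y_act_mult gh, simp add: Y_act_def)
    qed
    then show "Y_act (C \<otimes>\<^bsub>PSL2Q\<^esub> D) = Y_act C \<otimes>\<^bsub>BijGroup Y\<^esub> Y_act D"
      using gh by (simp add: mult_PSL2Q BijGroup_def Y_act_Bij)
  qed
  then show ?thesis
    by (simp add: group_action_def group_hom_def group_hom_axioms_def group_PSL2Q group_BijGroup)
qed

context haar_dual
begin

lemma Y_act_measurable:
  assumes g: "det g = 1"
  shows "Y_act {g, - g} \<in> measurable (Y_measure m) (Y_measure m)"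
proof (rule measurable_from_Y)
  have "(\<lambda>\<phi>. Y_proj (dual_act g \<phi>)) \<in> measurable m (Y_measure m)"
    by (rule measurable_compose[OF dual_act_measurable Y_proj_measurable])
  then show "(\<lambda>\<phi>. Y_act {g, - g} (Y_proj \<phi>)) \<in> measurable m (Y_measure m)"
    by (rule measurable_cong[THEN iffD1, rotated]) (simp add: Y_act_proj g space_m)
qed

lemma Y_act_preserving:
  assumes g: "det g = 1"
  shows "distr (Y_measure m) (Y_measure m) (Y_act {g, - g}) = Y_measure m"
proof -
  have "distr (distr m (Y_measure m) Y_proj) (Y_measure m) (Y_act {g, - g})
      = distr m (Y_measure m) (Y_act {g, - g} \<circ> Y_proj)"
    by (rule distr_distr[OF Y_act_measurable[OF g] Y_proj_measurable])
  also have "\<dots> = distr m (Y_measure m) (Y_proj \<circ> dual_act g)"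
    by (rule distr_cong) (simp_all add: space_m Y_act_proj g)
  also have "\<dots> = distr (distr m m (dual_act g)) (Y_measure m) Y_proj"
    by (rule distr_distr[symmetric, OF Y_proj_measurable dual_act_measurable])
  finally show ?thesis by (simp only: Y_measure_distr distr_dual_act[OF g])
qed

theorem pmp_action_Y: "pmp_action PSL2Q (Y_measure m) Y_act"
  by (intro pmp_action.intro pmp_action_axioms.intro)
    (auto simp: space_Y_measure group_action_Y prob_space_Y carrier_PSL2Q Y_act_measurable Y_act_preserving)

section \<open>Freeness\<close>

text \<open>A character \<open>\<phi>\<close> fixed by \<open>g\<close> takes the value one at \<open>g\<inverse> v - v\<close>, and a character that \<open>g\<close> maps
to its flip takes the value one at \<open>g\<inverse> u + u\<close>. Since \<open>g \<noteq> \<plusminus> 1\<close>, both vectors can be chosen to be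
nonzero.\<close>

lemma AE_dual_act_moves:
  assumes g: "det g = 1" "g \<noteq> mat 1" "g \<noteq> - mat 1"
  shows "AE \<phi> in m. dual_act g \<phi> \<noteq> \<phi> \<and> dual_act g \<phi> \<noteq> flip \<phi>"
proof -
  let ?h = "matrix_inv g"
  have "?h \<noteq> mat 1" using det_one_inverse(2)[OF g(1)] g(2) by auto
  then obtain v where v: "?h *v v \<noteq> v" by (auto simp: matrix_eq)
  have "?h \<noteq> - mat 1"
  proof
    assume "?h = - mat 1"
    then have "- g = mat 1" using det_one_inverse(2)[OF g(1)] by (simp add: minus_matrix_mult)
    then show False using g(3) by (metis minus_minus)
  qed
  then obtain u where u: "?h *v u \<noteq> - u" by (auto simp: matrix_eq minus_matrix_mult)
  have "?h *v v - v \<noteq> 0" "?h *v u + u \<noteq> 0" using u v by (auto simp: add_eq_0_iff2)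
  then have "AE \<phi> in m. \<phi> (?h *v v - v) \<noteq> 1" "AE \<phi> in m. \<phi> (?h *v u + u) \<noteq> 1"
    by (simp_all add: AE_character_neq_one)
  with AE_space show ?thesis
  proof eventually_elim
    case (elim \<phi>)
    then have \<phi>: "\<phi> \<in> dual" by (simp add: space_m)
    have unit: "\<phi> w * \<phi> (- w) = 1" for w
      using dual_add[OF \<phi>, of w "- w"] by (simp add: dual_zero[OF \<phi>])
    have "dual_act g \<phi> v \<noteq> \<phi> v"
      using elim(2) dual_add[OF \<phi>, of "?h *v v" "- v"] unit[of v] by (auto simp: dual_act_def)
    moreover have "dual_act g \<phi> u \<noteq> \<phi> (- u)"
      using elim(3) dual_add[OF \<phi>, of "?h *v u" u] unit[of u] by (auto simp: dual_act_def mult.commute)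
    ultimately show ?case by metis
  qed
qed

theorem essentially_free_Y: "essentially_free PSL2Q (Y_measure m) Y_act"
  unfolding essentially_free_def
proof (rule AE_Y_measure)
  have "AE \<phi> in m. \<forall>g :: rat^2^2. det g = 1 \<longrightarrow> g \<noteq> mat 1 \<longrightarrow> g \<noteq> - mat 1 \<longrightarrow>
      dual_act g \<phi> \<noteq> \<phi> \<and> dual_act g \<phi> \<noteq> flip \<phi>"
    unfolding AE_all_countable by (intro allI AE_impI AE_dual_act_moves)
  with AE_space show "AE \<phi> in m. stabilizer PSL2Q Y_act (Y_proj \<phi>) = {\<one>\<^bsub>PSL2Q\<^esub>}"
  proof eventually_elim
    case (elim \<phi>)
    then have \<phi>: "\<phi> \<in> dual" by (simp add: space_m)
    have "C = {mat 1, - mat 1}" if C: "C \<in> carrier PSL2Q" "Y_act C (Y_proj \<phi>) = Y_proj \<phi>" for C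
    proof -
      obtain g where g: "det g = 1" "C = {g, - g}" using C(1) by (auto simp: carrier_PSL2Q)
      have "Y_proj (dual_act g \<phi>) = Y_proj \<phi>" using C(2) by (simp add: g Y_act_proj \<phi>)
      then have "dual_act g \<phi> = \<phi> \<or> dual_act g \<phi> = flip \<phi>"
        by (rule Y_proj_eq_iff[OF dual_act_in_dual[OF \<phi>] \<phi>, THEN iffD1])
      then have "g = mat 1 \<or> g = - mat 1" using elim(2) g(1) by blast
      then show ?thesis using g(2) by auto
    qed
    moreover have "{mat 1, - mat 1} \<in> carrier PSL2Q" by (auto simp: carrier_PSL2Q)
    moreover have "Y_act {mat 1, - mat 1} (Y_proj \<phi>) = Y_proj \<phi>" using \<phi> by (simp add: Y_act_one Y_eq)
    ultimately show ?case unfolding stabilizer_def one_PSL2Q by blast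
  qed
qed

section \<open>Weak mixing\<close>

text \<open>The action permutes frequencies.\<close>

lemma fourier_dual_act:
  assumes g: "det g = 1" and h: "h \<in> borel_measurable m"
  shows "fourier (\<lambda>\<phi>. h (dual_act g \<phi>)) x = fourier h (g *v x)"
proof -
  have "fourier h (g *v x) = (\<integral>\<phi>. h (dual_act g \<phi>) * Re (dual_act g \<phi> (g *v x)) \<partial>m)"
    unfolding fourier_def by (rule integral_dual_act[symmetric]) (use assms in auto)
  then show ?thesis by (simp add: fourier_def dual_act_def det_one_inverse_vec[OF g])
qed

definition hyperbolic :: "nat \<Rightarrow> rat^2^2" where
  "hyperbolic n = vector [vector [2 ^ n, 0], vector [0, 1 / 2 ^ n]]"

lemma det_hyperbolic: "det (hyperbolic n) = 1"
  by (simp add: hyperbolic_def det_2)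

lemma hyperbolic_orbit_inj:
  assumes "x \<noteq> 0"
  shows "inj (\<lambda>n. hyperbolic n *v x)"
proof (rule injI)
  fix k n assume "hyperbolic k *v x = hyperbolic n *v x"
  then have "2 ^ k * x $ 1 = 2 ^ n * x $ 1" "1 / 2 ^ k * x $ 2 = 1 / 2 ^ n * x $ 2"
    by (simp_all add: hyperbolic_def vec_eq_iff forall_2 matrix_vector_mult_def sum_2)
  moreover have "x $ 1 \<noteq> 0 \<or> x $ 2 \<noteq> 0" using assms by (auto simp: vec_eq_iff forall_2)
  ultimately have "(2::rat) ^ k = 2 ^ n" by auto
  then show "k = n" by simp
qed

text \<open>Expand the integral by Parseval over a fixed finite set of frequencies; every term with \<open>x \<noteq> 0\<close>
tends to zero by the Riemann-Lebesgue lemma.\<close>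

lemma hyperbolic_mixing:
  assumes f: "unit_bounded f" and ev: "even_on_dual f" and h: "unit_bounded h"
  shows "(\<lambda>n. \<integral>\<phi>. f \<phi> * h (dual_act (hyperbolic n) \<phi>) \<partial>m) \<longlonglongrightarrow> (\<integral>\<phi>. f \<phi> \<partial>m) * (\<integral>\<phi>. h \<phi> \<partial>m)"
proof (rule LIMSEQ_I)
  fix r :: real assume r: "0 < r"
  obtain F where F: "finite F" "{0} \<subseteq> F" and pars: "\<And>g. unit_bounded g \<Longrightarrow>
      \<bar>(\<integral>\<phi>. f \<phi> * g \<phi> \<partial>m) - (\<Sum>x\<in>F. fourier f x * fourier g x)\<bar> \<le> r / 2"
    using parseval[OF f ev, of "{0}" "r / 2"] r by auto
  have "(\<lambda>n. \<Sum>x\<in>F. fourier f x * fourier h (hyperbolic n *v x))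
      \<longlonglongrightarrow> (\<Sum>x\<in>F. if x = 0 then fourier f x * fourier h 0 else 0)"
  proof (rule tendsto_sum)
    fix x
    show "(\<lambda>n. fourier f x * fourier h (hyperbolic n *v x)) \<longlonglongrightarrow> (if x = 0 then fourier f x * fourier h 0 else 0)"
    proof (cases "x = 0")
      case False
      have "(\<lambda>n. fourier f x * fourier h (hyperbolic n *v x)) \<longlonglongrightarrow> fourier f x * 0"
        by (intro tendsto_mult tendsto_const riemann_lebesgue[OF h hyperbolic_orbit_inj[OF False]])
      then show ?thesis using False by simp
    qed simp
  qed
  also have "(\<Sum>x\<in>F. if x = 0 then fourier f x * fourier h 0 else 0) = (\<integral>\<phi>. f \<phi> \<partial>m) * (\<integral>\<phi>. h \<phi> \<partial>m)"
    using F by (simp add: fourier_zero)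
  finally have "\<exists>N. \<forall>n\<ge>N. norm ((\<Sum>x\<in>F. fourier f x * fourier h (hyperbolic n *v x)) - (\<integral>\<phi>. f \<phi> \<partial>m) * (\<integral>\<phi>. h \<phi> \<partial>m)) < r / 2"
    by (rule LIMSEQ_D) (use r in simp)
  then obtain N where N: "\<And>n. n \<ge> N \<Longrightarrow>
      \<bar>(\<Sum>x\<in>F. fourier f x * fourier h (hyperbolic n *v x)) - (\<integral>\<phi>. f \<phi> \<partial>m) * (\<integral>\<phi>. h \<phi> \<partial>m)\<bar> < r / 2"
    unfolding real_norm_def by blast
  have "\<bar>(\<integral>\<phi>. f \<phi> * h (dual_act (hyperbolic n) \<phi>) \<partial>m) - (\<integral>\<phi>. f \<phi> \<partial>m) * (\<integral>\<phi>. h \<phi> \<partial>m)\<bar> < r" if "n \<ge> N" for n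
    using N[OF that] pars[OF unit_bounded_dual_act[OF h, of "hyperbolic n"]]
    unfolding fourier_dual_act[OF det_hyperbolic unit_boundedD(1)[OF h]] by linarith
  then show "\<exists>N. \<forall>n\<ge>N. norm ((\<integral>\<phi>. f \<phi> * h (dual_act (hyperbolic n) \<phi>) \<partial>m) - (\<integral>\<phi>. f \<phi> \<partial>m) * (\<integral>\<phi>. h \<phi> \<partial>m)) < r"
    by (auto simp: real_norm_def)
qed

lemma measure_Y_act_inter:
  assumes g: "det g = 1" and A: "A \<in> sets (Y_measure m)" and B: "B \<in> sets (Y_measure m)"
  defines "A' \<equiv> Y_proj -` A \<inter> dual" and "B' \<equiv> Y_proj -` B \<inter> dual"
  shows "measure (Y_measure m) (Y_act {g, - g} ` A \<inter> B)
    = (\<integral>\<phi>. indicator A' \<phi> * indicator B' (dual_act g \<phi>) \<partial>m)"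
proof -
  have AB: "A' \<in> sets m" "B' \<in> sets m" "A \<subseteq> Y" "B \<subseteq> Y"
    using A B by (auto simp: sets_Y_measure A'_def B'_def)
  note AB(1,2)[measurable]
  have ig: "det (matrix_inv g) = 1" by (rule det_matrix_inv[OF g])
  let ?S = "{\<phi> \<in> space m. dual_act (matrix_inv g) \<phi> \<in> A' \<and> \<phi> \<in> B'}"
  have pre: "Y_proj -` (Y_act {g, - g} ` A \<inter> B) \<inter> dual = ?S"
  proof (intro equalityI subsetI)
    fix \<phi> assume "\<phi> \<in> Y_proj -` (Y_act {g, - g} ` A \<inter> B) \<inter> dual"
    then obtain a where a: "a \<in> A" "Y_proj \<phi> = Y_act {g, - g} a" "\<phi> \<in> dual" "Y_proj \<phi> \<in> B" by auto
    obtain \<psi> where \<psi>: "\<psi> \<in> dual" "a = Y_proj \<psi>" using a(1) AB(3) by (auto simp: Y_eq)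
    have "Y_proj (dual_act (matrix_inv g) \<phi>) = Y_act {matrix_inv g, - matrix_inv g} (Y_act {g, - g} a)"
      unfolding a(2)[symmetric] by (rule Y_act_proj[OF ig a(3), symmetric])
    also have "\<dots> = a" using a(1) AB(3) by (auto simp: Y_act_mult[OF ig g] det_one_inverse[OF g] Y_act_one)
    finally show "\<phi> \<in> ?S" using a by (simp add: A'_def B'_def space_m dual_act_in_dual)
  next
    fix \<phi> assume "\<phi> \<in> ?S"
    then have \<phi>: "\<phi> \<in> dual" "Y_proj (dual_act (matrix_inv g) \<phi>) \<in> A" "Y_proj \<phi> \<in> B"
      by (auto simp: A'_def B'_def space_m)
    have "Y_act {g, - g} (Y_proj (dual_act (matrix_inv g) \<phi>)) = Y_proj \<phi>"
      using \<phi>(1) by (simp add: Y_act_proj g dual_act_in_dual dual_act_inverse)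
    then show "\<phi> \<in> Y_proj -` (Y_act {g, - g} ` A \<inter> B) \<inter> dual"
      using \<phi> by (auto intro: rev_image_eqI)
  qed
  have S: "?S \<in> sets m" by measurable
  have "Y_act {g, - g} ` A \<inter> B \<in> sets (Y_measure m)"
    unfolding sets_Y_measure mem_Collect_eq pre using S AB(4) by blast
  then have "measure (Y_measure m) (Y_act {g, - g} ` A \<inter> B) = measure m ?S"
    by (simp only: measure_Y_measure pre)
  also have "\<dots> = (\<integral>\<phi>. indicator ?S \<phi> \<partial>m)" using S by simp
  also have "\<dots> = (\<integral>\<phi>. indicator ?S (dual_act g \<phi>) \<partial>m)"
    by (rule integral_dual_act[symmetric]) (use g S in auto)
  also have "\<dots> = (\<integral>\<phi>. indicator A' \<phi> * indicator B' (dual_act g \<phi>) \<partial>m)"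
    by (rule Bochner_Integration.integral_cong)
      (auto simp: indicator_def space_m dual_act_in_dual dual_act_inverse[OF g])
  finally show ?thesis .
qed

lemma even_indicator: "even_on_dual (indicator (Y_proj -` A \<inter> dual))"
  by (auto simp: even_on_dual_def indicator_def Y_proj_flip flip_in_dual)

theorem weakly_mixing_Y: "weakly_mixing PSL2Q (Y_measure m) Y_act"
  unfolding weakly_mixing_def
proof (intro allI impI; elim conjE)
  fix \<Omega> and \<epsilon> :: real
  assume \<Omega>: "finite \<Omega>" "\<Omega> \<subseteq> sets (Y_measure m)" and \<epsilon>: "\<epsilon> > 0"
  let ?C = "\<lambda>n. {hyperbolic n, - hyperbolic n}"
  have "eventually (\<lambda>n. \<bar>measure (Y_measure m) (Y_act (?C n) ` A \<inter> B)
      - measure (Y_measure m) A * measure (Y_measure m) B\<bar> < \<epsilon>) sequentially"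
    if "A \<in> \<Omega>" "B \<in> \<Omega>" for A B
  proof -
    have AB: "A \<in> sets (Y_measure m)" "B \<in> sets (Y_measure m)" using that \<Omega> by auto
    then have AB': "Y_proj -` A \<inter> dual \<in> sets m" "Y_proj -` B \<inter> dual \<in> sets m" by (auto simp: sets_Y_measure)
    have "(\<lambda>n. measure (Y_measure m) (Y_act (?C n) ` A \<inter> B)) \<longlonglongrightarrow> measure (Y_measure m) A * measure (Y_measure m) B"
      using hyperbolic_mixing[OF unit_bounded_indicator[OF AB'(1)] even_indicator unit_bounded_indicator[OF AB'(2)]]
      by (simp add: measure_Y_act_inter[OF det_hyperbolic AB] measure_Y_measure AB AB' del: Int_iff)
    from tendstoD[OF this \<epsilon>] show ?thesis by (simp only: dist_real_def)
  qed
  then have "eventually (\<lambda>n. \<forall>A\<in>\<Omega>. \<forall>B\<in>\<Omega>. \<bar>measure (Y_measure m) (Y_act (?C n) ` A \<inter> B)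
      - measure (Y_measure m) A * measure (Y_measure m) B\<bar> < \<epsilon>) sequentially"
    using \<Omega>(1) by (intro eventually_ball_finite ballI) auto
  then obtain n where "\<forall>A\<in>\<Omega>. \<forall>B\<in>\<Omega>. \<bar>measure (Y_measure m) (Y_act (?C n) ` A \<inter> B)
      - measure (Y_measure m) A * measure (Y_measure m) B\<bar> < \<epsilon>" by (auto simp: eventually_sequentially)
  moreover have "?C n \<in> carrier PSL2Q" by (auto simp: carrier_PSL2Q det_hyperbolic)
  ultimately show "\<exists>s\<in>carrier PSL2Q. \<forall>A\<in>\<Omega>. \<forall>B\<in>\<Omega>. \<bar>measure (Y_measure m) (Y_act s ` A \<inter> B)
      - measure (Y_measure m) A * measure (Y_measure m) B\<bar> < \<epsilon>" by blast
qed

end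

section \<open>Functions that factor through a map\<close>

text \<open>The Doob-Dynkin lemma. The sublevel sets of \<open>f\<close> at rational levels are preimages of measurable
sets \<open>A q\<close>, and \<open>k z\<close> is the infimum of the levels \<open>q\<close> with \<open>z \<in> A q\<close>. Where no level qualifies,
the infimum is infinite; this happens only outside the image of \<open>P\<close>; for this reason it is taken in the
extended reals.\<close>

lemma factor_through_vimage_algebra:
  fixes f :: "'a \<Rightarrow> real"
  assumes P: "P \<in> S \<rightarrow> space N" and f: "f \<in> borel_measurable (vimage_algebra S P N)"
  shows "\<exists>k \<in> borel_measurable N. \<forall>x \<in> S. f x = k (P x)"
proof -
  have "\<exists>A \<in> sets N. {x \<in> S. f x < real_of_rat q} = P -` A \<inter> S" for q
  proof -
    have "{x \<in> space (vimage_algebra S P N). f x < real_of_rat q} \<in> sets (vimage_algebra S P N)"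
      using f by measurable
    then show ?thesis by (auto simp: sets_vimage_algebra2[OF P])
  qed
  then obtain A where A: "\<And>q. A q \<in> sets N" "\<And>q. {x \<in> S. f x < real_of_rat q} = P -` A q \<inter> S"
    by metis
  note A(1)[measurable]
  define k where "k z = (INF q. if z \<in> A q then ereal (real_of_rat q) else \<infinity>)" for z
  have k: "k \<in> borel_measurable N" unfolding k_def by measurable
  have kP: "k (P x) = ereal (f x)" if x: "x \<in> S" for x
  proof -
    have iff: "P x \<in> A q \<longleftrightarrow> f x < real_of_rat q" for q using A(2)[of q] x by blast
    have "ereal (f x) \<le> k (P x)"
      unfolding k_def iff by (rule INF_greatest) auto
    moreover have "k (P x) \<le> ereal (f x)"
    proof (rule ccontr)
      assume "\<not> k (P x) \<le> ereal (f x)"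
      then obtain r where r: "ereal (f x) < ereal (real_of_rat r)" "ereal (real_of_rat r) < k (P x)"
        using ereal_dense3[of "ereal (f x)" "k (P x)"] by (auto simp: not_le)
      have "k (P x) \<le> (if P x \<in> A r then ereal (real_of_rat r) else \<infinity>)"
        unfolding k_def by (rule INF_lower) simp
      then show False using r by (simp add: iff)
    qed
    ultimately show ?thesis by (rule antisym[rotated])
  qed
  have "(\<lambda>z. real_of_ereal (k z)) \<in> borel_measurable N" using k by measurable
  then show ?thesis using kP by (intro bexI[of _ "\<lambda>z. real_of_ereal (k z)"]) auto
qed

section \<open>Determinants and transvections\<close>

text \<open>The determinant of the matrix with columns \<open>v\<close> and \<open>w\<close>.\<close>

definition area :: "rat^2 \<Rightarrow> rat^2 \<Rightarrow> rat" where
  "area v w = v $ 1 * w $ 2 - v $ 2 * w $ 1"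

text \<open>The matrix of \<open>x \<mapsto> x + t * area v x *s v\<close>, a unipotent element fixing \<open>v\<close>.\<close>

definition transvection :: "rat^2 \<Rightarrow> rat \<Rightarrow> rat^2^2" where
  "transvection v t = vector [vector [1 - t * v $ 1 * v $ 2, t * v $ 1 * v $ 1],
     vector [- (t * v $ 2 * v $ 2), 1 + t * v $ 1 * v $ 2]]"

lemma det_transvection: "det (transvection v t) = 1"
  by (simp add: transvection_def det_2 algebra_simps)

lemma transvection_apply: "transvection v t *v x = x + (t * area v x) *s v"
  by (simp add: transvection_def area_def vec_eq_iff forall_2 matrix_vector_mult_def sum_2 algebra_simps)

lemma area_self: "area v v = 0"
  by (simp add: area_def)

lemma area_combination: "area v (s *s v + t *s w) = t * area v w" "area (s *s v + t *s w) w = s * area v w"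
  by (simp_all add: area_def algebra_simps)

lemma proportional:
  assumes "v \<noteq> 0" "area v w = 0"
  shows "\<exists>q. w = q *s v"
proof (cases "v $ 1 = 0")
  case True
  then have "v $ 2 \<noteq> 0" using assms(1) by (auto simp: vec_eq_iff forall_2)
  then show ?thesis using True assms(2)
    by (intro exI[of _ "w $ 2 / v $ 2"]) (auto simp: vec_eq_iff forall_2 area_def)
next
  case False
  then show ?thesis using assms(2)
    by (intro exI[of _ "w $ 1 / v $ 1"]) (auto simp: vec_eq_iff forall_2 area_def field_simps)
qed

definition e\<^sub>1 :: "rat^2" where "e\<^sub>1 = vector [1, 0]"

lemma e1_nonzero: "e\<^sub>1 \<noteq> 0"
  by (simp add: e\<^sub>1_def vec_eq_iff forall_2)

lemma transitive_on_nonzero: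
  assumes "v \<noteq> 0"
  shows "\<exists>g :: rat^2^2. det g = 1 \<and> g *v e\<^sub>1 = v"
proof (cases "v $ 1 = 0")
  case True
  then have "v $ 2 \<noteq> 0" using assms by (auto simp: vec_eq_iff forall_2)
  then show ?thesis using True
    by (intro exI[of _ "vector [vector [0, - 1 / v $ 2], vector [v $ 2, 0]]"])
      (simp add: det_2 e\<^sub>1_def vec_eq_iff forall_2 matrix_vector_mult_def sum_2)
next
  case False
  then show ?thesis
    by (intro exI[of _ "vector [vector [v $ 1, 0], vector [v $ 2, 1 / v $ 1]]"])
      (simp add: det_2 e\<^sub>1_def vec_eq_iff forall_2 matrix_vector_mult_def sum_2)
qed

lemma scale_injective:
  fixes v :: "rat^2"
  assumes "v \<noteq> 0"
  shows "s *s v = t *s v \<longleftrightarrow> s = t"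
  using assms by (auto simp: vec_eq_iff forall_2)

section \<open>Conditional expectations of characters\<close>

text \<open>A factor of the action on \<open>Y\<close>, seen from the dual: \<open>P\<close> is the composition of the projection
to \<open>Y\<close> with the factor map, and \<open>\<beta> g\<close> is the action of the coset of \<open>g\<close>.\<close>

locale even_factor = haar_dual m for m +
  fixes N :: "'z measure" and P :: "(rat^2 \<Rightarrow> complex) \<Rightarrow> 'z" and \<beta> :: "rat^2^2 \<Rightarrow> 'z \<Rightarrow> 'z"
  assumes P_measurable [measurable]: "P \<in> measurable m N"
    and distr_P: "distr m N P = N"
    and P_flip: "\<phi> \<in> dual \<Longrightarrow> P (flip \<phi>) = P \<phi>"
    and \<beta>_measurable: "det g = 1 \<Longrightarrow> \<beta> g \<in> measurable N N"
    and equivariant: "det g = 1 \<Longrightarrow> AE \<phi> in m. P (dual_act g \<phi>) = \<beta> g (P \<phi>)"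
begin

definition unit_function :: "('z \<Rightarrow> real) \<Rightarrow> bool" where
  "unit_function h \<longleftrightarrow> h \<in> borel_measurable N \<and> (\<forall>z. \<bar>h z\<bar> \<le> 1)"

lemma unit_bounded_P: "unit_function h \<Longrightarrow> unit_bounded (\<lambda>\<phi>. h (P \<phi>))"
  by (auto simp: unit_function_def unit_bounded_def intro: measurable_compose[OF P_measurable])

lemma unit_function_mult: "unit_function h \<Longrightarrow> unit_function k \<Longrightarrow> unit_function (\<lambda>z. h z * k z)"
  by (auto simp: unit_function_def abs_mult intro: mult_le_one)

lemma unit_function_one: "unit_function (\<lambda>z. 1)"
  by (simp add: unit_function_def)

lemma even_P: "even_on_dual (\<lambda>\<phi>. h (P \<phi>))"
  by (simp add: even_on_dual_def P_flip)

text \<open>The conditional expectation is represented by a function on the factor space and truncated to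
\<open>[-1, 1]\<close>, which changes it only on a null set.\<close>

lemma conditional_expectation_exists:
  assumes g: "unit_bounded g"
  shows "\<exists>k. unit_function k \<and>
    (\<forall>h. unit_function h \<longrightarrow> (\<integral>\<phi>. k (P \<phi>) * h (P \<phi>) \<partial>m) = (\<integral>\<phi>. g \<phi> * h (P \<phi>) \<partial>m))"
proof -
  let ?F = "vimage_algebra (space m) P N"
  have PX: "P \<in> space m \<rightarrow> space N" using measurable_space[OF P_measurable] by auto
  have sub: "Conditional_Expectation.subalgebra m ?F"
    unfolding Conditional_Expectation.subalgebra_def using measurable_sets[OF P_measurable] by (auto simp: sets_vimage_algebra2[OF PX])
  interpret F: finite_measure_subalgebra m ?F by unfold_locales (rule sub)
  let ?E = "real_cond_exp m ?F g"
  obtain k where k: "k \<in> borel_measurable N" "\<And>\<phi>. \<phi> \<in> space m \<Longrightarrow> ?E \<phi> = k (P \<phi>)"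
    using factor_through_vimage_algebra[OF PX borel_measurable_cond_exp] by blast
  have g_int: "integrable m g" by (rule unit_boundedD(3)[OF g])
  have ge: "AE \<phi> in m. - 1 \<le> ?E \<phi>"
    by (rule F.real_cond_exp_ge_c[OF g_int]) (use unit_boundedD(2)[OF g] in \<open>auto simp: space_m abs_le_iff intro!: AE_I2\<close>)
  have le: "AE \<phi> in m. ?E \<phi> \<le> 1"
    by (rule F.real_cond_exp_le_c[OF g_int]) (use unit_boundedD(2)[OF g] in \<open>auto simp: space_m abs_le_iff intro!: AE_I2\<close>)
  define k' where "k' = (\<lambda>z. max (- 1) (min 1 (k z)))"
  have ae: "AE \<phi> in m. k' (P \<phi>) = ?E \<phi>"
    using ge le AE_space by eventually_elim (simp add: k'_def k(2)[symmetric])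
  have "k' \<in> borel_measurable N" unfolding k'_def using k(1) by measurable
  then have k': "unit_function k'" by (auto simp: unit_function_def k'_def)
  have "(\<integral>\<phi>. k' (P \<phi>) * h (P \<phi>) \<partial>m) = (\<integral>\<phi>. g \<phi> * h (P \<phi>) \<partial>m)" if h: "unit_function h" for h
  proof -
    have hN: "h \<in> borel_measurable N" using h by (simp add: unit_function_def)
    have hF: "(\<lambda>\<phi>. h (P \<phi>)) \<in> borel_measurable ?F"
      by (rule measurable_compose[OF measurable_vimage_algebra1[OF PX] hN])
    have Em: "?E \<in> borel_measurable m" by simp
    have "(\<integral>\<phi>. k' (P \<phi>) * h (P \<phi>) \<partial>m) = (\<integral>\<phi>. h (P \<phi>) * ?E \<phi> \<partial>m)"
    proof (rule integral_cong_AE)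
      show "AE \<phi> in m. k' (P \<phi>) * h (P \<phi>) = h (P \<phi>) * ?E \<phi>"
        using ae by eventually_elim (simp add: mult.commute)
      show "(\<lambda>\<phi>. k' (P \<phi>) * h (P \<phi>)) \<in> borel_measurable m"
        using unit_bounded_P[OF unit_function_mult[OF k' h]] by (rule unit_boundedD(1))
      show "(\<lambda>\<phi>. h (P \<phi>) * ?E \<phi>) \<in> borel_measurable m"
        using unit_boundedD(1)[OF unit_bounded_P[OF h]] Em by (rule borel_measurable_times)
    qed
    also have "\<dots> = (\<integral>\<phi>. h (P \<phi>) * g \<phi> \<partial>m)"
      by (rule F.real_cond_exp_intg(2)[OF _ hF unit_boundedD(1)[OF g]])
        (rule unit_boundedD(3)[OF unit_bounded_mult[OF unit_bounded_P[OF h] g]])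
    finally show ?thesis by (simp add: mult.commute)
  qed
  then show ?thesis using k' by blast
qed

definition cond :: "rat^2 \<Rightarrow> 'z \<Rightarrow> real" where
  "cond v = (SOME k. unit_function k \<and> (\<forall>h. unit_function h \<longrightarrow>
    (\<integral>\<phi>. k (P \<phi>) * h (P \<phi>) \<partial>m) = (\<integral>\<phi>. Re (\<phi> v) * h (P \<phi>) \<partial>m)))"

lemma cond_unit: "unit_function (cond v)"
  and cond_integral: "unit_function h \<Longrightarrow> (\<integral>\<phi>. cond v (P \<phi>) * h (P \<phi>) \<partial>m) = (\<integral>\<phi>. Re (\<phi> v) * h (P \<phi>) \<partial>m)"
  using someI_ex[OF conditional_expectation_exists[OF unit_bounded_Re[of v]]] unfolding cond_def[symmetric] by blast+

abbreviation D :: "rat^2 \<Rightarrow> (rat^2 \<Rightarrow> complex) \<Rightarrow> real" where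
  "D v \<equiv> \<lambda>\<phi>. cond v (P \<phi>)"

lemma D_bounded: "unit_bounded (D v)"
  by (rule unit_bounded_P[OF cond_unit])

definition coeff :: "rat^2 \<Rightarrow> rat^2 \<Rightarrow> real" where
  "coeff v x = fourier (D v) x"

lemma coeff_eq: "coeff v x = (\<integral>\<phi>. D x \<phi> * D v \<phi> \<partial>m)"
  unfolding coeff_def fourier_def cond_integral[OF cond_unit] by (simp add: mult.commute)

lemma coeff_commute: "coeff v x = coeff x v"
  unfolding coeff_eq by (simp add: mult.commute)

lemma coeff_minus: "coeff v (- x) = coeff v x"
  by (simp add: coeff_def fourier_minus)

lemma coeff_zero: "v \<noteq> 0 \<Longrightarrow> coeff v 0 = 0"
  using cond_integral[OF unit_function_one, of v] by (simp add: coeff_def fourier_zero integral_Re)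

lemma unit_bounded_AE_integral:
  assumes "AE \<phi> in m. f \<phi> = (g \<phi> :: real)" "f \<in> borel_measurable m" "g \<in> borel_measurable m"
    "u \<in> borel_measurable m"
  shows "(\<integral>\<phi>. f \<phi> * u \<phi> \<partial>m) = (\<integral>\<phi>. g \<phi> * u \<phi> \<partial>m)"
proof (rule integral_cong_AE)
  show "AE \<phi> in m. f \<phi> * u \<phi> = g \<phi> * u \<phi>" using assms(1) by eventually_elim simp
qed (use assms in auto)

text \<open>The function \<open>\<phi> \<mapsto> D (g v) (g \<phi>)\<close> is, up to a null set, a function of \<open>P \<phi>\<close>, and a change of
variables shows that it has the property that characterises the conditional expectation of
\<open>Re (\<phi> v)\<close>.\<close>

lemma D_equivariant:
  assumes g: "det g = 1"
  shows "AE \<phi> in m. D (g *v v) (dual_act g \<phi>) = D v \<phi>"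
proof -
  define g' where "g' = matrix_inv g"
  have g': "det g' = 1" unfolding g'_def by (rule det_matrix_inv[OF g])
  define k where "k = (\<lambda>z. cond (g *v v) (\<beta> g z))"
  have k: "unit_function k"
    using cond_unit[of "g *v v"] measurable_compose[OF \<beta>_measurable[OF g], of "cond (g *v v)" borel]
    by (auto simp: unit_function_def k_def)
  have kP: "AE \<phi> in m. D (g *v v) (dual_act g \<phi>) = k (P \<phi>)"
    using equivariant[OF g] by eventually_elim (simp add: k_def)
  have m1: "(\<lambda>\<phi>. D (g *v v) (dual_act g \<phi>)) \<in> borel_measurable m"
    by (rule unit_boundedD(1)[OF unit_bounded_dual_act[OF D_bounded]])
  have kh: "(\<integral>\<phi>. k (P \<phi>) * h (P \<phi>) \<partial>m) = (\<integral>\<phi>. Re (\<phi> v) * h (P \<phi>) \<partial>m)" if h: "unit_function h" for h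
  proof -
    define h' where "h' = (\<lambda>z. h (\<beta> g' z))"
    have h': "unit_function h'"
      using h measurable_compose[OF \<beta>_measurable[OF g'], of h borel]
      by (auto simp: unit_function_def h'_def)
    have hP: "AE \<phi> in m. h (P (dual_act g' \<phi>)) = h' (P \<phi>)"
      using equivariant[OF g'] by eventually_elim (simp add: h'_def)
    have m2: "(\<lambda>\<phi>. h (P (dual_act g' \<phi>))) \<in> borel_measurable m"
      by (rule unit_boundedD(1)[OF unit_bounded_dual_act[OF unit_bounded_P[OF h]]])
    have m3: "(\<lambda>\<phi>. h' (P \<phi>)) \<in> borel_measurable m"
      by (rule unit_boundedD(1)[OF unit_bounded_P[OF h']])
    have inv: "dual_act g' (dual_act g \<phi>) = \<phi>" for \<phi>
      unfolding g'_def by (rule dual_act_inverse(2)[OF g])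
    have "(\<integral>\<phi>. k (P \<phi>) * h (P \<phi>) \<partial>m) = (\<integral>\<phi>. D (g *v v) (dual_act g \<phi>) * h (P \<phi>) \<partial>m)"
      by (rule unit_bounded_AE_integral[OF kP, symmetric])
        (use m1 in \<open>auto intro: unit_boundedD(1)[OF unit_bounded_P] k h\<close>)
    also have "\<dots> = (\<integral>\<phi>. D (g *v v) (dual_act g \<phi>) * h (P (dual_act g' (dual_act g \<phi>))) \<partial>m)"
      by (simp only: inv)
    also have "\<dots> = (\<integral>\<phi>. D (g *v v) \<phi> * h (P (dual_act g' \<phi>)) \<partial>m)"
      by (rule integral_dual_act[OF g, of "\<lambda>\<phi>. D (g *v v) \<phi> * h (P (dual_act g' \<phi>))"])
        (rule borel_measurable_times[OF unit_boundedD(1)[OF D_bounded] m2])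
    also have "\<dots> = (\<integral>\<phi>. h' (P \<phi>) * D (g *v v) \<phi> \<partial>m)"
      by (subst mult.commute)
        (rule unit_bounded_AE_integral[OF hP m2 m3 unit_boundedD(1)[OF D_bounded]])
    also have "\<dots> = (\<integral>\<phi>. h' (P \<phi>) * Re (\<phi> (g *v v)) \<partial>m)"
      using cond_integral[OF h', of "g *v v"] by (simp add: mult.commute)
    also have "\<dots> = (\<integral>\<phi>. h (P (dual_act g' \<phi>)) * Re (\<phi> (g *v v)) \<partial>m)"
      by (rule unit_bounded_AE_integral[OF hP m2 m3, symmetric]) simp
    also have "\<dots> = (\<integral>\<phi>. h (P (dual_act g' (dual_act g \<phi>))) * Re (dual_act g \<phi> (g *v v)) \<partial>m)"
      by (rule integral_dual_act[OF g, symmetric]) (use m2 in auto)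
    also have "\<dots> = (\<integral>\<phi>. Re (\<phi> v) * h (P \<phi>) \<partial>m)"
      unfolding inv by (simp add: dual_act_def det_one_inverse_vec[OF g] mult.commute)
    finally show ?thesis .
  qed
  \<comment> \<open>Testing the difference of the two functions against itself; halving it keeps it bounded by one.\<close>
  define h where "h z = (k z - cond v z) / 2" for z
  have h: "unit_function h"
    using k cond_unit[of v] unfolding unit_function_def h_def
    by (auto simp: abs_le_iff) (smt (verit, ccfv_SIG) field_sum_of_halves)+
  have int: "integrable m (\<lambda>\<phi>. u (P \<phi>) * h (P \<phi>))" if "unit_function u" for u
    by (rule unit_boundedD(3)[OF unit_bounded_P[OF unit_function_mult[OF that h]]])
  have eq: "h z * x = (k z * x - cond v z * x) / 2" for z x by (simp add: h_def algebra_simps)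
  have "(\<integral>\<phi>. h (P \<phi>) * h (P \<phi>) \<partial>m) = (\<integral>\<phi>. (k (P \<phi>) * h (P \<phi>) - cond v (P \<phi>) * h (P \<phi>)) / 2 \<partial>m)"
    by (rule Bochner_Integration.integral_cong[OF refl eq])
  also have "\<dots> = 0"
    using int[OF k] int[OF cond_unit[of v]] by (simp add: kh[OF h] cond_integral[OF h])
  finally have "AE \<phi> in m. h (P \<phi>) * h (P \<phi>) = 0"
    using integral_nonneg_eq_0_iff_AE[OF int[OF h]] by simp
  with kP show ?thesis by eventually_elim (simp add: h_def)
qed

lemma coeff_invariant:
  assumes g: "det g = 1"
  shows "coeff (g *v v) (g *v x) = coeff v x"
proof -
  have "coeff (g *v v) (g *v x) = fourier (\<lambda>\<phi>. D (g *v v) (dual_act g \<phi>)) x"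
    unfolding coeff_def by (rule fourier_dual_act[OF g unit_boundedD(1)[OF D_bounded], symmetric])
  also have "\<dots> = fourier (D v) x"
    unfolding fourier_def
    by (rule unit_bounded_AE_integral[OF D_equivariant[OF g]])
      (auto intro: unit_boundedD(1)[OF D_bounded] unit_boundedD(1)[OF unit_bounded_dual_act[OF D_bounded]])
  finally show ?thesis by (simp add: coeff_def)
qed

text \<open>The transvections along \<open>v\<close> fix \<open>v\<close> and move \<open>w\<close> to infinitely many frequencies, at all of which
\<open>D v\<close> has the same coefficient.\<close>

lemma coeff_independent:
  assumes vw: "area v w \<noteq> 0"
  shows "coeff v w = 0"
proof -
  have v: "v \<noteq> 0" using vw by (auto simp: area_def)
  let ?x = "\<lambda>n::nat. transvection v (of_nat n) *v w"
  have "inj ?x"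
  proof (rule injI)
    fix k n assume "?x k = ?x n"
    then have "(of_nat k * area v w) *s v = (of_nat n * area v w) *s v" by (simp add: transvection_apply)
    then show "k = n" using vw v by (simp add: scale_injective[OF v])
  qed
  moreover have "fourier (D v) (?x n) = coeff v w" for n
  proof -
    have "transvection v (of_nat n) *v v = v" by (simp add: transvection_apply area_self)
    then show ?thesis using coeff_invariant[OF det_transvection[of v "of_nat n"], of v w] by (simp add: coeff_def)
  qed
  ultimately show ?thesis using fourier_constant_on_infinite[OF D_bounded] by blast
qed

definition ratio :: "rat \<Rightarrow> real" where
  "ratio s = coeff e\<^sub>1 (s *s e\<^sub>1)"

lemma matrix_vector_scale: "(g :: rat^2^2) *v (s *s x) = s *s (g *v x)"
  by (simp add: vec_eq_iff matrix_vector_mult_def sum_distrib_left mult.left_commute)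

lemma coeff_proportional:
  assumes "v \<noteq> 0"
  shows "coeff v (s *s v) = ratio s"
proof -
  obtain g :: "rat^2^2" where g: "det g = 1" "g *v e\<^sub>1 = v" using transitive_on_nonzero[OF assms] by blast
  have "coeff (g *v e\<^sub>1) (g *v (s *s e\<^sub>1)) = coeff e\<^sub>1 (s *s e\<^sub>1)" by (rule coeff_invariant[OF g(1)])
  then show ?thesis by (simp add: g(2) matrix_vector_scale ratio_def)
qed

lemma ratio_zero: "ratio 0 = 0"
  unfolding ratio_def by (simp add: coeff_zero[OF e1_nonzero])

lemma ratio_minus: "ratio (- s) = ratio s"
  using coeff_minus[of e\<^sub>1 "s *s e\<^sub>1"] by (simp add: ratio_def)

lemma ratio_inverse:
  assumes "s \<noteq> 0"
  shows "ratio (1 / s) = ratio s"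
proof -
  have "s *s e\<^sub>1 \<noteq> 0" using assms scale_injective[OF e1_nonzero, of s 0] by simp
  then have "ratio (1 / s) = coeff (s *s e\<^sub>1) ((1 / s) *s (s *s e\<^sub>1))" by (rule coeff_proportional[symmetric])
  also have "(1 / s) *s (s *s e\<^sub>1) = e\<^sub>1" using assms by simp
  finally show ?thesis by (simp add: ratio_def coeff_commute[of _ e\<^sub>1])
qed

text \<open>In the product \<open>D v * D w\<close> only the frequency \<open>s v\<close> of the first factor and \<open>t w\<close> of the second
one, up to sign, combine to the frequency \<open>s v + t w\<close>, because \<open>v\<close> and \<open>w\<close> are independent.
The third conditional expectation can be dropped since the other two factors are
functions of \<open>P \<phi>\<close>.\<close>

lemma triple_integral:
  assumes vw: "area v w \<noteq> 0"
  shows "(\<integral>\<phi>. D v \<phi> * D w \<phi> * D (s *s v + t *s w) \<phi> \<partial>m) = ratio s * ratio t"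
proof -
  define u where "u = s *s v + t *s w"
  have v: "v \<noteq> 0" and w: "w \<noteq> 0" using vw by (auto simp: area_def)
  let ?g = "\<lambda>\<phi>. D v \<phi> * Re (\<phi> u)"
  have g: "unit_bounded ?g" by (rule unit_bounded_mult[OF D_bounded unit_bounded_Re])
  have four: "fourier (D w) (q *s w) * fourier ?g (q *s w)
      = (if q = t \<or> q = - t then (if t = 0 then 0 else ratio s * ratio t / 2) else 0)" for q
  proof -
    have sh: "coeff v (s *s v + r *s w) = (if r = 0 then ratio s else 0)" for r
    proof (cases "r = 0")
      case True
      then show ?thesis using coeff_proportional[OF v, of s] by simp
    next
      case False
      then show ?thesis using coeff_independent[of v "s *s v + r *s w"] vw by (simp add: area_combination)
    qed
    have uq: "u + q *s w = s *s v + (t + q) *s w" "u - q *s w = s *s v + (t - q) *s w"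
      by (simp_all add: u_def vec_eq_iff algebra_simps)
    have "fourier ?g (q *s w) = (coeff v (s *s v + (t + q) *s w) + coeff v (s *s v + (t - q) *s w)) / 2"
      by (simp only: fourier_mult_Re[OF D_bounded] coeff_def uq)
    also have "\<dots> = ((if q = - t then ratio s else 0) + (if q = t then ratio s else 0)) / 2"
      unfolding sh by (auto simp: eq_neg_iff_add_eq_0 add.commute)
    finally have 1: "fourier ?g (q *s w) = ((if q = - t then ratio s else 0) + (if q = t then ratio s else 0)) / 2" .
    have 2: "fourier (D w) (q *s w) = ratio q" using coeff_proportional[OF w] by (simp add: coeff_def)
    show ?thesis unfolding 1 2 by (auto simp: ratio_minus ratio_zero)
  qed
  have "(\<integral>\<phi>. D w \<phi> * ?g \<phi> \<partial>m) = (\<Sum>x\<in>{t *s w, - t *s w}. fourier (D w) x * fourier ?g x)"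
  proof (rule parseval_finite[OF D_bounded even_P g])
    fix x assume x: "x \<notin> {t *s w, - t *s w}"
    show "fourier (D w) x * fourier ?g x = 0"
    proof (cases "area w x = 0")
      case True
      then obtain q where "x = q *s w" using proportional[OF w] by blast
      then show ?thesis using x four[of q] by auto
    next
      case False
      then show ?thesis using coeff_independent[OF False] by (simp add: coeff_def)
    qed
  qed simp
  also have "\<dots> = ratio s * ratio t"
  proof (cases "t = 0")
    case True
    then show ?thesis using four[of 0] by (simp add: ratio_zero)
  next
    case False
    then have "t *s w \<noteq> - t *s w" unfolding scale_injective[OF w] by simp
    then have "(\<Sum>x\<in>{t *s w, - t *s w}. fourier (D w) x * fourier ?g x)
        = fourier (D w) (t *s w) * fourier ?g (t *s w) + fourier (D w) (- t *s w) * fourier ?g (- t *s w)"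
      by (subst sum.insert) auto
    then show ?thesis using False by (simp only: four) simp
  qed
  finally have "(\<integral>\<phi>. D w \<phi> * ?g \<phi> \<partial>m) = ratio s * ratio t" .
  moreover have "(\<integral>\<phi>. D w \<phi> * ?g \<phi> \<partial>m) = (\<integral>\<phi>. Re (\<phi> u) * (cond v (P \<phi>) * cond w (P \<phi>)) \<partial>m)"
    by (simp add: mult_ac)
  moreover have "(\<integral>\<phi>. Re (\<phi> u) * (cond v (P \<phi>) * cond w (P \<phi>)) \<partial>m) = (\<integral>\<phi>. cond u (P \<phi>) * (cond v (P \<phi>) * cond w (P \<phi>)) \<partial>m)"
    by (rule cond_integral[OF unit_function_mult[OF cond_unit cond_unit], symmetric])
  ultimately show ?thesis by (simp add: u_def mult_ac)
qed

text \<open>The triple integral is symmetric, so with \<open>u = s v + t w\<close> it can also be evaluated by writing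
\<open>v = (1 / s) u - (t / s) w\<close> in terms of the independent vectors \<open>u\<close> and \<open>w\<close>.\<close>

lemma ratio_relation:
  assumes s: "s \<noteq> 0"
  shows "ratio s * ratio t = ratio s * ratio (t / s)"
proof -
  define w :: "rat^2" where "w = vector [0, 1]"
  define u where "u = s *s e\<^sub>1 + t *s w"
  have ew: "area e\<^sub>1 w \<noteq> 0" by (simp add: area_def e\<^sub>1_def w_def)
  have uw: "area u w \<noteq> 0" unfolding u_def area_combination using s ew by simp
  have e: "e\<^sub>1 = (1 / s) *s u + (- t / s) *s w"
    using s by (simp add: u_def vec_eq_iff forall_2 field_simps)
  have "ratio s * ratio t = (\<integral>\<phi>. D e\<^sub>1 \<phi> * D w \<phi> * D u \<phi> \<partial>m)"
    unfolding u_def by (rule triple_integral[OF ew, symmetric])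
  also have "\<dots> = (\<integral>\<phi>. D u \<phi> * D w \<phi> * D e\<^sub>1 \<phi> \<partial>m)" by (simp add: mult_ac)
  also have "\<dots> = (\<integral>\<phi>. D u \<phi> * D w \<phi> * D ((1 / s) *s u + (- t / s) *s w) \<phi> \<partial>m)"
    by (simp only: e[symmetric])
  also have "\<dots> = ratio (1 / s) * ratio (- t / s)" by (rule triple_integral[OF uw])
  finally show ?thesis using ratio_minus[of "t / s"] by (simp add: ratio_inverse[OF s])
qed

text \<open>By the previous relation \<open>ratio\<close> takes the same nonzero value on all powers of \<open>s\<close>. A rational
number other than \<open>\<plusminus> 1\<close> and zero has infinitely many powers.\<close>

lemma ratio_support:
  assumes "ratio s \<noteq> 0"
  shows "s = 1 \<or> s = - 1"
proof (rule ccontr)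
  assume ns: "\<not> (s = 1 \<or> s = - 1)"
  have s: "s \<noteq> 0" using assms ratio_zero by auto
  have step: "ratio t = ratio (t / s)" for t using ratio_relation[OF s, of t] assms by simp
  have pow: "ratio (s ^ n) = ratio 1" for n
  proof (induction n)
    case (Suc n)
    then show ?case using step[of "s ^ Suc n"] s by simp
  qed simp
  have "inj (\<lambda>n. s ^ n *s e\<^sub>1)"
  proof (rule injI)
    fix k n assume "s ^ k *s e\<^sub>1 = s ^ n *s e\<^sub>1"
    then have "s ^ k = s ^ n" by (simp only: scale_injective[OF e1_nonzero])
    then have "\<bar>s\<bar> ^ k = \<bar>s\<bar> ^ n" by (simp flip: power_abs)
    then show "k = n" using ns s by (subst (asm) power_inject_exp') (auto simp: abs_if split: if_splits)
  qed
  moreover have "fourier (D e\<^sub>1) (s ^ n *s e\<^sub>1) = ratio 1" for n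
    using pow[of n] by (simp add: ratio_def coeff_def)
  ultimately have "ratio 1 = 0" by (rule fourier_constant_on_infinite[OF D_bounded])
  then show False using pow[of 1] assms by simp
qed

lemma coeff_support:
  assumes "v \<noteq> 0" "coeff v x \<noteq> 0"
  shows "x = v \<or> x = - v"
proof -
  have "area v x = 0" using coeff_independent assms(2) by blast
  then obtain q where q: "x = q *s v" using proportional[OF assms(1)] by blast
  then have "ratio q \<noteq> 0" using assms coeff_proportional by simp
  then show ?thesis using ratio_support[of q] q by auto
qed

text \<open>The only frequencies of \<open>D v\<close> are \<open>\<plusminus> v\<close>, and the squared norm of \<open>D v\<close> equals its coefficient at
\<open>v\<close> because \<open>D v\<close> is a projection of \<open>Re (\<phi> v)\<close>. Parseval gives \<open>ratio 1 = 2 * (ratio 1)\<^sup>2\<close>.\<close>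

lemma ratio_one: "ratio 1 = 0 \<or> ratio 1 = 1 / 2"
proof -
  let ?v = e\<^sub>1
  have ne: "?v \<noteq> - ?v" by (simp add: e\<^sub>1_def vec_eq_iff forall_2)
  have "(\<integral>\<phi>. D ?v \<phi> * D ?v \<phi> \<partial>m) = (\<Sum>x\<in>{?v, - ?v}. fourier (D ?v) x * fourier (D ?v) x)"
    by (rule parseval_finite[OF D_bounded even_P D_bounded])
      (use coeff_support[OF e1_nonzero] in \<open>auto simp: coeff_def\<close>)
  also have "\<dots> = coeff ?v ?v * coeff ?v ?v + coeff ?v (- ?v) * coeff ?v (- ?v)"
    using ne by (simp add: coeff_def)
  finally have "coeff ?v ?v = 2 * (coeff ?v ?v * coeff ?v ?v)" unfolding coeff_eq[symmetric] coeff_minus by simp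
  moreover have "coeff ?v ?v = ratio 1" by (simp add: ratio_def)
  ultimately have "ratio 1 * (2 * ratio 1 - 1) = 0" by (simp add: algebra_simps)
  then show ?thesis by auto
qed

lemma D_norm:
  assumes "v \<noteq> 0"
  shows "(\<integral>\<phi>. D v \<phi> * D v \<phi> \<partial>m) = ratio 1"
  using coeff_proportional[OF assms, of 1] by (simp add: coeff_eq)

text \<open>In the two cases for \<open>ratio 1\<close>, the squared distance of \<open>D v\<close> to zero, respectively to
\<open>Re (\<phi> v)\<close>, vanishes.\<close>

theorem conditional_expectation_dichotomy:
  "(\<forall>v. v \<noteq> 0 \<longrightarrow> (AE \<phi> in m. D v \<phi> = 0)) \<or> (\<forall>v. v \<noteq> 0 \<longrightarrow> (AE \<phi> in m. D v \<phi> = Re (\<phi> v)))"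
  using ratio_one
proof
  assume c: "ratio 1 = 0"
  have "AE \<phi> in m. D v \<phi> = 0" if v: "v \<noteq> 0" for v
  proof -
    have "AE \<phi> in m. D v \<phi> * D v \<phi> = 0"
      using integral_nonneg_eq_0_iff_AE[OF unit_boundedD(3)[OF unit_bounded_mult[OF D_bounded D_bounded]], of v v]
        D_norm[OF v] c by simp
    then show ?thesis by simp
  qed
  then show ?thesis by blast
next
  assume c: "ratio 1 = 1 / 2"
  have "AE \<phi> in m. D v \<phi> = Re (\<phi> v)" if v: "v \<noteq> 0" for v
  proof -
    let ?r = "\<lambda>\<phi>. D v \<phi> * D v \<phi> - 2 * (D v \<phi> * Re (\<phi> v)) + Re (\<phi> v) * Re (\<phi> v)"
    have sq: "?r \<phi> = (D v \<phi> - Re (\<phi> v))\<^sup>2" for \<phi> by (simp add: power2_eq_square algebra_simps)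
    have ints: "integrable m (\<lambda>\<phi>. D v \<phi> * D v \<phi>)" "integrable m (\<lambda>\<phi>. D v \<phi> * Re (\<phi> v))"
      "integrable m (\<lambda>\<phi>. Re (\<phi> v) * Re (\<phi> v))"
      by (intro unit_boundedD(3) unit_bounded_mult D_bounded unit_bounded_Re)+
    have 1: "(\<integral>\<phi>. D v \<phi> * Re (\<phi> v) \<partial>m) = ratio 1"
      using coeff_proportional[OF v, of 1] by (simp add: coeff_def fourier_def)
    have ne: "v \<noteq> - v" using v by (auto simp: vec_eq_iff forall_2)
    have 2: "(\<integral>\<phi>. Re (\<phi> v) * Re (\<phi> v) \<partial>m) = 1 / 2"
      using fourier_Re[of v v] ne by (simp add: fourier_def)
    have "(\<integral>\<phi>. ?r \<phi> \<partial>m) = 0" using ints D_norm[OF v] 1 2 c by simp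
    moreover have "integrable m ?r" using ints by simp
    moreover have "AE \<phi> in m. 0 \<le> ?r \<phi>" unfolding sq by simp
    ultimately have "AE \<phi> in m. ?r \<phi> = 0" using integral_nonneg_eq_0_iff_AE by blast
    then show ?thesis unfolding sq by simp
  qed
  then show ?thesis by blast
qed

end

section \<open>Factors on standard Borel spaces\<close>

definition separating :: "'z measure \<Rightarrow> 'z set set \<Rightarrow> bool" where
  "separating N \<B> \<longleftrightarrow> countable \<B> \<and> \<B> \<subseteq> sets N \<and>
    (\<forall>z \<in> space N. \<forall>w \<in> space N. (\<forall>V \<in> \<B>. z \<in> V \<longleftrightarrow> w \<in> V) \<longrightarrow> z = w)"

lemma separatingD:
  assumes "separating N \<B>"
  shows "countable \<B>" "\<B> \<subseteq> sets N"
    "z \<in> space N \<Longrightarrow> w \<in> space N \<Longrightarrow> \<forall>V \<in> \<B>. z \<in> V \<longleftrightarrow> w \<in> V \<Longrightarrow> z = w"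
  using assms by (simp_all add: separating_def)

lemma standard_borel_separating:
  assumes "standard_borel N"
  shows "\<exists>\<B>. separating N \<B>"
proof -
  obtain T where T: "completely_metrizable_space T" "second_countable T" "topspace T = space N"
    "sets N = sigma_sets (topspace T) {U. openin T U}"
    using assms by (auto simp: standard_borel_def)
  have H: "Hausdorff_space T"
    by (intro metrizable_imp_Hausdorff_space completely_metrizable_imp_metrizable_space T)
  obtain \<B> where B: "countable \<B>" "\<forall>V \<in> \<B>. openin T V"
    "\<forall>U x. openin T U \<and> x \<in> U \<longrightarrow> (\<exists>V \<in> \<B>. x \<in> V \<and> V \<subseteq> U)"
    using T(2) by (auto simp: second_countable_def)
  have "\<B> \<subseteq> sets N" using B(2) by (auto simp: T(4))
  moreover have "z = w" if z: "z \<in> space N" "w \<in> space N" and eq: "\<forall>V \<in> \<B>. z \<in> V \<longleftrightarrow> w \<in> V" for z w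
  proof (rule ccontr)
    assume "z \<noteq> w"
    then obtain U W where "openin T U" "openin T W" "z \<in> U" "w \<in> W" "disjnt U W"
      using H z unfolding Hausdorff_space_def T(3) by meson
    moreover obtain V where "V \<in> \<B>" "z \<in> V" "V \<subseteq> U"
      using B(3) \<open>openin T U\<close> \<open>z \<in> U\<close> by meson
    ultimately show False using eq by (auto simp: disjnt_iff)
  qed
  ultimately have "separating N \<B>" using B(1) by (simp add: separating_def)
  then show ?thesis ..
qed

text \<open>Almost every point lies in exactly those members of a countable separating family that have full
measure, and there is at most one such point.\<close>

lemma zero_one_imp_one_point:
  assumes "standard_borel N" "prob_space N"
    and zo: "\<And>A. A \<in> sets N \<Longrightarrow> measure N A = 0 \<or> measure N A = 1"
  shows "one_point_mod_null N"
proof -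
  interpret prob_space N by fact
  obtain \<B> where "separating N \<B>" using standard_borel_separating[OF assms(1)] ..
  note B = separatingD[OF this]
  have "AE w in N. \<forall>V \<in> \<B>. w \<in> V \<longleftrightarrow> measure N V = 1"
    unfolding AE_ball_countable[OF B(1)]
  proof
    fix V assume "V \<in> \<B>"
    then have V: "V \<in> sets N" using B(2) by blast
    from zo[OF V] show "AE w in N. w \<in> V \<longleftrightarrow> measure N V = 1"
    proof
      assume 0: "measure N V = 0"
      then have "V \<in> null_sets N" using V by (simp add: null_sets_def emeasure_eq_measure)
      then have "AE w in N. w \<notin> V" by (rule AE_not_in)
      then show ?thesis using 0 by simp
    next
      assume 1: "measure N V = 1"
      then have "AE w in N. w \<in> V" using prob_eq_1[OF V] by simp
      then show ?thesis using 1 by simp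
    qed
  qed
  with AE_space have ae: "AE w in N. w \<in> space N \<and> (\<forall>V \<in> \<B>. w \<in> V \<longleftrightarrow> measure N V = 1)"
    by eventually_elim simp
  have "\<exists>z. z \<in> space N \<and> (\<forall>V \<in> \<B>. z \<in> V \<longleftrightarrow> measure N V = 1)"
  proof (rule ccontr)
    assume "\<not> ?thesis"
    with ae have "AE w in N. False" by (simp only: not_ex)
    then show False by simp
  qed
  then obtain z where z: "z \<in> space N" "\<forall>V \<in> \<B>. z \<in> V \<longleftrightarrow> measure N V = 1" by blast
  have "AE w in N. w = z"
    using ae by eventually_elim (rule B(3), use z in simp_all)
  then show ?thesis using z(1) by (auto simp: one_point_mod_null_def)
qed

text \<open>A countable separating family turns equality of two points into countably many measurable
conditions.\<close>

lemma fixed_points_measurable: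
  assumes "standard_borel N" "f \<in> measurable N N"
  shows "{z \<in> space N. f z = z} \<in> sets N"
proof -
  obtain \<B> where "separating N \<B>" using standard_borel_separating[OF assms(1)] ..
  note B = separatingD[OF this]
  have fz: "f z \<in> space N" if "z \<in> space N" for z using measurable_space[OF assms(2) that] .
  have "z \<in> {z \<in> space N. f z = z} \<longleftrightarrow> z \<in> {z \<in> space N. \<forall>V \<in> \<B>. f z \<in> V \<longleftrightarrow> z \<in> V}" for z
    using B(3)[of "f z" z] fz[of z] by auto
  then have "{z \<in> space N. f z = z} = {z \<in> space N. \<forall>V \<in> \<B>. f z \<in> V \<longleftrightarrow> z \<in> V}" by blast
  also have "\<dots> \<in> sets N"
  proof (rule sets.sets_Collect_countable_All'[OF _ B(1)])
    fix V assume "V \<in> \<B>"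
    then have V: "V \<in> sets N" using B(2) by auto
    show "{z \<in> space N. f z \<in> V \<longleftrightarrow> z \<in> V} \<in> sets N" using V assms(2) by measurable
  qed
  finally show ?thesis .
qed

context even_factor
begin

lemma prob_space_N: "prob_space N"
  using prob_space_distr[OF P_measurable] by (simp add: distr_P)

text \<open>The indicator function \<open>f\<close> of a set of the factor has no frequency other than zero, so Parseval
shows that its squared norm is the square of its integral.\<close>

lemma trivial_case:
  assumes triv: "\<And>v. v \<noteq> 0 \<Longrightarrow> AE \<phi> in m. D v \<phi> = 0" and A: "A \<in> sets N"
  shows "measure N A = 0 \<or> measure N A = 1"
proof -
  let ?f = "\<lambda>\<phi>. indicator A (P \<phi>) :: real"
  have uA: "unit_function (indicator A)" using A by (auto simp: unit_function_def indicator_def)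
  have f: "unit_bounded ?f" by (rule unit_bounded_P[OF uA])
  have "fourier ?f x = 0" if x: "x \<noteq> 0" for x
  proof -
    have "fourier ?f x = (\<integral>\<phi>. Re (\<phi> x) * ?f \<phi> \<partial>m)" by (simp add: fourier_def mult.commute)
    also have "\<dots> = (\<integral>\<phi>. D x \<phi> * ?f \<phi> \<partial>m)" by (rule cond_integral[OF uA, symmetric])
    also have "\<dots> = (\<integral>\<phi>. 0 * ?f \<phi> \<partial>m)"
      by (rule unit_bounded_AE_integral[OF triv[OF x]]) (auto intro: unit_boundedD(1)[OF D_bounded] unit_boundedD(1)[OF f])
    finally show ?thesis by simp
  qed
  then have "(\<integral>\<phi>. ?f \<phi> * ?f \<phi> \<partial>m) = (\<Sum>x\<in>{0}. fourier ?f x * fourier ?f x)"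
    by (intro parseval_finite[OF f even_P f]) auto
  moreover have "?f \<phi> * ?f \<phi> = ?f \<phi>" for \<phi> by (simp add: indicator_def)
  moreover have "(\<integral>\<phi>. ?f \<phi> \<partial>m) = measure N A"
  proof -
    have "(\<integral>\<phi>. ?f \<phi> \<partial>m) = (\<integral>z. indicator A z \<partial>distr m N P)"
      by (rule integral_distr[symmetric]) (use A in auto)
    then show ?thesis using A sets.sets_into_space[OF A] by (simp add: distr_P Int_absorb2)
  qed
  ultimately have "measure N A = measure N A * measure N A" by (simp add: fourier_zero)
  then have "measure N A * (measure N A - 1) = 0" by (simp add: algebra_simps)
  then show ?thesis by auto
qed

end

section \<open>Recovering a point of the quotient\<close>

text \<open>With \<open>r v = Re (\<phi> v)\<close> and \<open>Im (\<phi> e\<^sub>1) \<noteq> 0\<close>, the numerator is \<open>Im (\<phi> e\<^sub>1) * Im (\<phi> w)\<close> and the root is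
\<open>\<bar>Im (\<phi> e\<^sub>1)\<bar>\<close>. The second component is therefore \<open>Im (\<phi> w)\<close> up to a sign that does not depend
on \<open>w\<close>.\<close>

definition character_from_real_parts :: "(rat^2 \<Rightarrow> real) \<Rightarrow> rat^2 \<Rightarrow> complex" where
  "character_from_real_parts r w =
     Complex (r w) ((r e\<^sub>1 * r w - r (e\<^sub>1 + w)) / sqrt (1 - (r e\<^sub>1)\<^sup>2))"

lemma character_from_real_parts:
  assumes \<phi>: "\<phi> \<in> dual" and ne: "\<phi> (e\<^sub>1 + e\<^sub>1) \<noteq> 1"
  shows "character_from_real_parts (\<lambda>v. Re (\<phi> v)) \<in> {\<phi>, flip \<phi>}"
proof -
  let ?i = "Im (\<phi> e\<^sub>1)"
  have unit: "(Re (\<phi> e\<^sub>1))\<^sup>2 + ?i\<^sup>2 = 1" using dual_norm[OF \<phi>, of e\<^sub>1] by (simp add: norm_complex_def)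
  have i: "?i \<noteq> 0"
  proof
    assume "?i = 0"
    then have "\<phi> (e\<^sub>1 + e\<^sub>1) = 1" using unit dual_add[OF \<phi>, of e\<^sub>1 e\<^sub>1]
      by (simp add: complex_eq_iff power2_eq_square)
    then show False using ne by simp
  qed
  have root: "sqrt (1 - (Re (\<phi> e\<^sub>1))\<^sup>2) = \<bar>?i\<bar>"
  proof -
    have "1 - (Re (\<phi> e\<^sub>1))\<^sup>2 = ?i\<^sup>2" using unit by simp
    then show ?thesis by simp
  qed
  have num: "Re (\<phi> e\<^sub>1) * Re (\<phi> w) - Re (\<phi> (e\<^sub>1 + w)) = ?i * Im (\<phi> w)" for w
    by (simp add: dual_add[OF \<phi>])
  show ?thesis
  proof (cases "?i > 0")
    case True
    then have "character_from_real_parts (\<lambda>v. Re (\<phi> v)) = \<phi>"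
      by (auto simp: fun_eq_iff character_from_real_parts_def root num complex_eq_iff)
    then show ?thesis by simp
  next
    case False
    then have "character_from_real_parts (\<lambda>v. Re (\<phi> v)) = flip \<phi>"
      using i by (auto simp: fun_eq_iff character_from_real_parts_def root num complex_eq_iff dual_uminus[OF \<phi>])
    then show ?thesis by simp
  qed
qed

context even_factor
begin

text \<open>Almost every \<open>\<phi>\<close> satisfies \<open>\<phi> (2 e\<^sub>1) \<noteq> 1\<close>, hence \<open>Im (\<phi> e\<^sub>1) \<noteq> 0\<close>, and the formula for
recovering \<open>\<phi>\<close> up to sign from the real parts applies.\<close>

lemma injective_case:
  assumes full: "\<And>v. v \<noteq> 0 \<Longrightarrow> AE \<phi> in m. D v \<phi> = Re (\<phi> v)"
  shows "\<exists>\<psi> \<in> measurable N (Y_measure m). AE \<phi> in m. \<psi> (P \<phi>) = Y_proj \<phi>"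
proof -
  \<comment> \<open>The hypothesis concerns nonzero frequencies only; at frequency zero a character has value one.\<close>
  define h where "h z v = (if v = 0 then 1 else cond v z)" for z v
  have hm: "(\<lambda>z. h z v) \<in> borel_measurable N" for v
    using cond_unit[of v] by (cases "v = 0") (auto simp: h_def unit_function_def)
  have "AE \<phi> in m. \<forall>v. h (P \<phi>) v = Re (\<phi> v)"
    unfolding AE_all_countable
  proof
    fix v
    show "AE \<phi> in m. h (P \<phi>) v = Re (\<phi> v)"
    proof (cases "v = 0")
      case True
      show ?thesis using AE_space by eventually_elim (simp add: True h_def space_m dual_zero)
    next
      case False
      show ?thesis using full[OF False] by eventually_elim (simp add: False h_def)
    qed
  qed
  then have hP: "AE \<phi> in m. h (P \<phi>) = (\<lambda>v. Re (\<phi> v))" by (simp add: fun_eq_iff)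
  let ?s = "\<lambda>z. character_from_real_parts (h z)"
  have coord: "(\<lambda>z. ?s z w) \<in> borel_measurable N" for w
  proof -
    have "(\<lambda>z. of_real (h z w) + \<i> * of_real ((h z e\<^sub>1 * h z w - h z (e\<^sub>1 + w)) / sqrt (1 - (h z e\<^sub>1)\<^sup>2)))
        \<in> borel_measurable N"
      using hm[of w] hm[of e\<^sub>1] hm[of "e\<^sub>1 + w"] by measurable
    moreover have "?s z w = of_real (h z w) + \<i> * of_real ((h z e\<^sub>1 * h z w - h z (e\<^sub>1 + w)) / sqrt (1 - (h z e\<^sub>1)\<^sup>2))" for z
      by (simp only: character_from_real_parts_def Complex_eq)
    ultimately show ?thesis by (simp only:)
  qed
  have "?s \<in> measurable N borel" by (rule measurable_coordinatewise_then_product[OF coord])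
  moreover have "dual \<in> sets borel" by (rule borel_closed[OF compact_imp_closed[OF compact_dual]])
  ultimately have "?s -` dual \<inter> space N \<in> sets N" by (rule measurable_sets)
  moreover have "?s -` dual \<inter> space N = {z \<in> space N. ?s z \<in> dual}" by auto
  ultimately have in_dual: "{z \<in> space N. ?s z \<in> dual} \<in> sets N" by (simp only:)
  \<comment> \<open>Off a null set the formula yields a character; elsewhere the trivial character is used.\<close>
  define t where "t z = (if ?s z \<in> dual then ?s z else (\<lambda>_. 1))" for z
  have t: "t \<in> measurable N m"
  proof (rule measurable_into_dual)
    fix w
    have "(\<lambda>z. if ?s z \<in> dual then ?s z w else 1) \<in> borel_measurable N"
      by (rule measurable_If) (rule coord, rule borel_measurable_const, rule in_dual)
    moreover have "t z w = (if ?s z \<in> dual then ?s z w else 1)" for z by (simp add: t_def)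
    ultimately show "(\<lambda>z. t z w) \<in> borel_measurable N" by (simp only:)
  qed (simp add: t_def one_in_dual)
  have "e\<^sub>1 + e\<^sub>1 \<noteq> 0" by (simp add: e\<^sub>1_def vec_eq_iff forall_2)
  from AE_character_neq_one[OF this] hP AE_space
  have "AE \<phi> in m. Y_proj (t (P \<phi>)) = Y_proj \<phi>"
  proof eventually_elim
    case (elim \<phi>)
    then have \<phi>: "\<phi> \<in> dual" by (simp add: space_m)
    have "?s (P \<phi>) \<in> {\<phi>, flip \<phi>}"
      unfolding elim(2) by (rule character_from_real_parts[OF \<phi> elim(1)])
    then consider "?s (P \<phi>) = \<phi>" | "?s (P \<phi>) = flip \<phi>" by blast
    then show ?case
    proof cases
      case 1
      then show ?thesis by (simp only: t_def \<phi> if_True)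
    next
      case 2
      then show ?thesis by (simp only: t_def flip_in_dual[OF \<phi>] if_True Y_proj_flip[OF \<phi>])
    qed
  qed
  then show ?thesis
    by (rule bexI[where x = "\<lambda>z. Y_proj (t z)"]) (rule measurable_compose[OF t Y_proj_measurable])
qed

end

context haar_dual
begin

lemma even_factor_from_Y:
  assumes act: "pmp_action PSL2Q N \<beta>" and fac: "factor_map PSL2Q (Y_measure m) Y_act N \<beta> \<pi>"
  shows "even_factor m N (\<lambda>\<phi>. \<pi> (Y_proj \<phi>)) (\<lambda>g. \<beta> {g, - g})"
proof
  have \<pi>: "\<pi> \<in> measurable (Y_measure m) N" and d: "distr (Y_measure m) N \<pi> = N"
    and eq: "\<And>C. C \<in> carrier PSL2Q \<Longrightarrow> AE y in Y_measure m. \<pi> (Y_act C y) = \<beta> C (\<pi> y)"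
    using fac by (auto simp: factor_map_def)
  show "(\<lambda>\<phi>. \<pi> (Y_proj \<phi>)) \<in> measurable m N" by (rule measurable_compose[OF Y_proj_measurable \<pi>])
  have "distr (distr m (Y_measure m) Y_proj) N \<pi> = distr m N (\<pi> \<circ> Y_proj)"
    by (rule distr_distr[OF \<pi> Y_proj_measurable])
  then show "distr m N (\<lambda>\<phi>. \<pi> (Y_proj \<phi>)) = N" by (simp add: Y_measure_distr d comp_def)
  show "\<pi> (Y_proj (flip \<phi>)) = \<pi> (Y_proj \<phi>)" if "\<phi> \<in> dual" for \<phi> using that by (simp add: Y_proj_flip)
  fix g :: "rat^2^2" assume g: "det g = 1"
  then have C: "{g, - g} \<in> carrier PSL2Q" by (auto simp: carrier_PSL2Q)
  show "\<beta> {g, - g} \<in> measurable N N" by (rule pmp_action.action_measurable[OF act C])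
  from AE_from_Y_measure[OF eq[OF C]] AE_space
  show "AE \<phi> in m. \<pi> (Y_proj (dual_act g \<phi>)) = \<beta> {g, - g} (\<pi> (Y_proj \<phi>))"
    by eventually_elim (simp add: Y_act_proj[OF g] space_m)
qed

text \<open>In the second case the measurable left inverse is also a right inverse almost everywhere, since the
measure of the factor is the image measure and the set where the composition is the identity is
measurable.\<close>

theorem prime_Y: "prime_action TYPE('z) PSL2Q (Y_measure m) Y_act"
  unfolding prime_action_def
proof (intro allI impI; elim conjE)
  fix N :: "'z measure" and \<beta> \<pi>
  assume sb: "standard_borel N" and act: "pmp_action PSL2Q N \<beta>"
    and fac: "factor_map PSL2Q (Y_measure m) Y_act N \<beta> \<pi>"
  have \<pi>: "\<pi> \<in> measurable (Y_measure m) N" "distr (Y_measure m) N \<pi> = N"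
    using fac by (auto simp: factor_map_def)
  interpret even_factor m N "\<lambda>\<phi>. \<pi> (Y_proj \<phi>)" "\<lambda>g. \<beta> {g, - g}"
    by (rule even_factor_from_Y[OF act fac])
  from conditional_expectation_dichotomy show "one_point_mod_null N \<or> iso_mod_null (Y_measure m) N \<pi>"
  proof
    assume "\<forall>v. v \<noteq> 0 \<longrightarrow> (AE \<phi> in m. D v \<phi> = 0)"
    then have triv: "AE \<phi> in m. D v \<phi> = 0" if "v \<noteq> 0" for v using that by blast
    have "one_point_mod_null N"
      by (rule zero_one_imp_one_point[OF sb prob_space_N]) (rule trivial_case[OF triv])
    then show ?thesis ..
  next
    assume "\<forall>v. v \<noteq> 0 \<longrightarrow> (AE \<phi> in m. D v \<phi> = Re (\<phi> v))"
    then have full: "AE \<phi> in m. D v \<phi> = Re (\<phi> v)" if "v \<noteq> 0" for v using that by blast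
    obtain \<psi> where \<psi>: "\<psi> \<in> measurable N (Y_measure m)" "AE \<phi> in m. \<psi> (\<pi> (Y_proj \<phi>)) = Y_proj \<phi>"
      using injective_case[OF full] by (rule bexE)
    have 1: "AE y in Y_measure m. \<psi> (\<pi> y) = y" by (rule AE_Y_measure[OF \<psi>(2)])
    have meas: "{z \<in> space N. \<pi> (\<psi> z) = z} \<in> sets N"
      by (rule fixed_points_measurable[OF sb measurable_compose[OF \<psi>(1) \<pi>(1)]])
    have "AE y in Y_measure m. \<pi> (\<psi> (\<pi> y)) = \<pi> y" using 1 by eventually_elim simp
    then have "AE z in distr (Y_measure m) N \<pi>. \<pi> (\<psi> z) = z"
      by (subst AE_distr_iff[OF \<pi>(1) meas])
    then have 2: "AE z in N. \<pi> (\<psi> z) = z" by (simp only: \<pi>(2))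
    show ?thesis
      unfolding iso_mod_null_def
      by (rule disjI2, intro conjI \<pi>, rule bexI[of _ \<psi>], intro conjI 1 2, rule \<psi>(1))
  qed
qed

end

theorem corollary3p3:
  fixes m :: "(rat^2 \<Rightarrow> complex) measure"
  assumes "haar_prob m"
  shows "pmp_action PSL2Q (Y_measure m) Y_act
    \<and> essentially_free PSL2Q (Y_measure m) Y_act
    \<and> weakly_mixing PSL2Q (Y_measure m) Y_act
    \<and> prime_action TYPE('z) PSL2Q (Y_measure m) Y_act"
proof -
  interpret haar_dual m using assms by (simp add: haar_dual_def)
  show ?thesis by (intro conjI pmp_action_Y essentially_free_Y weakly_mixing_Y prime_Y)
qed

end
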